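(* Let $$M(1,1)\equiv M(1,1;t,w)=\sum_{n\ge0}t^n\sum_{(P,Q)\in\mathcal{I}_n}\sum_{j=1}^nw^{\tilde Q(j)-3\tilde P(j)}.$$ Let $z=z(t)$ be the formal power series with $t=z(1-z)^3$, $z=t+O(t^2)$. Let $$\begin{aligned}S(V,z,w)={}&V^5w^5z^5+V^5w^4z^5+V^5w^3z^5+5V^4w^5z^4+V^5w^2z^5-2V^4w^5z^3+5V^4w^4z^4-V^3w^4z^5+V^5wz^5\\&-2V^4w^4z^3+5V^4w^3z^4+2V^4w^2z^5+8V^3w^5z^3+3V^3w^4z^4-V^3w^3z^5-2V^4w^3z^3+4V^4w^2z^4+2V^4wz^5\\&-6V^3w^5z^2+5V^3w^4z^3+3V^3w^3z^4+V^3w^2z^5-2V^2w^4z^4-V^4w^2z^3+4V^4wz^4+V^3w^5z-5V^3w^4z^2\\&+5V^3w^3z^3+8V^3w^2z^4+V^3wz^5+4V^2w^5z^2+7V^2w^4z^3-2V^2w^3z^4-V^4wz^3+V^3w^4z-5V^3w^3z^2\\&+V^3w^2z^3+8V^3wz^4-4V^2w^5z-5V^2w^4z^2+7V^2w^3z^3+4V^2w^2z^4+V^3w^3z-V^3w^2z^2+V^3wz^3+V^2w^5\\&+V^2w^4z-5V^2w^3z^2+6V^2w^2z^3+4V^2wz^4-V^3wz^2-2V^3z^3+V^2w^3z-5V^2w^2z^2+5V^2wz^3+4Vw^2z^3\\&+V^3z^2+3V^2w^2z-2V^2wz^2-4V^2z^3-4Vw^2z^2+3Vwz^3-V^2w^2+3Vw^2z-Vwz^2-2Vz^3+V^2z-Vw^2\\&-3Vz^2+2Vz-2z^2+z,\end{aligned}$$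 and let $V_0=V_0(z,w)$ be the formal power series in $z$ (coefficients rational in $w$) with $V_0(0)=0$ and $S(V_0,z,w)=0$ (so $V_0=zw^{-2}+O(z^2)$). Then $M(1,1)$ is algebraic and, expressed in the variables $z,w$, $$M(1,1)=R(z,V_0),\qquad R(z,V)=\frac{(Vz^2-z^2+3z-1)Vw^2}{Vz^4-3Vz^3+3Vz^2+z^3-Vz-3z^2+3z-1}.$$
   Context: A Dyck path of size $n$ is a lattice path from $(0,0)$ to $(2n,0)$ with $n$ up-steps $(1,1)$ and $n$ down-steps $(1,-1)$ never going below height $0$. For $j\in\{1,\dots,n\}$, $\tilde P(j)$ is the height of the initial point of the $j$-th up-step of $P$. The Tamari order is the reflexive transitive closure of the relation: if $P$ has a down-step $d$ immediately followed by an up-step and $\mathfrak{e}$ is the shortest excursion following $d$ (staying strictly above its starting height except at its last point), the path obtained by exchanging $d$ and $\mathfrak{e}$ is larger than $P$. $\mathcal{I}_n$ is the set of pairs $(P,Q)$ of Dyck paths of size $n$ with $P\le Q$ ($P$ lower, $Q$ upper path). $M(1,1)$ is a formal power series in $t$ with coefficients Laurent polynomials in $w$. *)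

theory Defs
  imports "HOL-Computational_Algebra.Computational_Algebra"
begin

text \<open>Paths are lists of steps: True = up-step (1,1), False = down-step (1,-1).\<close>

definition ht :: "bool list \<Rightarrow> int" where
  "ht xs = int (count_list xs True) - int (count_list xs False)"

definition nonneg_path :: "bool list \<Rightarrow> bool" where
  "nonneg_path xs \<longleftrightarrow> (\<forall>i\<le>length xs. ht (take i xs) \<ge> 0)"

definition dyck :: "nat \<Rightarrow> bool list \<Rightarrow> bool" where
  "dyck n P \<longleftrightarrow> length P = 2 * n \<and> count_list P True = n \<and> nonneg_path P \<and> ht P = 0"

fun up_heights :: "int \<Rightarrow> bool list \<Rightarrow> int list" where
  "up_heights h [] = []"
| "up_heights h (True # xs) = h # up_heights (h + 1) xs"
| "up_heights h (False # xs) = up_heights (h - 1) xs"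

definition tilde :: "bool list \<Rightarrow> nat \<Rightarrow> int" where
  "tilde P j = up_heights 0 P ! (j - 1)"

text \<open>Shortest excursion starting with an up-step: stays strictly above its starting
  height except at its endpoints.\<close>
definition prime_excursion :: "bool list \<Rightarrow> bool" where
  "prime_excursion e \<longleftrightarrow> (\<exists>e'. e = True # e' @ [False] \<and> nonneg_path e' \<and> ht e' = 0)"

definition tamari_step :: "bool list \<Rightarrow> bool list \<Rightarrow> bool" where
  "tamari_step P Q \<longleftrightarrow> (\<exists>A e B. P = A @ [False] @ e @ B \<and> prime_excursion e \<and>
                                   Q = A @ e @ [False] @ B)"

definition tamari_le :: "bool list \<Rightarrow> bool list \<Rightarrow> bool" where
  "tamari_le = tamari_step\<^sup>*\<^sup>*"

definition intervals :: "nat \<Rightarrow> (bool list \<times> bool list) set" where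
  "intervals n = {(P, Q). dyck n P \<and> dyck n Q \<and> tamari_le P Q}"

definition wvar :: "rat poly fract" where
  "wvar = Fract [:0, 1:] 1"

definition M11 :: "rat poly fract fps" where
  "M11 = Abs_fps (\<lambda>n. \<Sum>(P, Q) \<in> intervals n. \<Sum>j = 1..n. wvar powi (tilde Q j - 3 * tilde P j))"

definition S_pol :: "'a::comm_ring_1 \<Rightarrow> 'a \<Rightarrow> 'a \<Rightarrow> 'a" where
  "S_pol V z w = V^5*w^5*z^5 + V^5*w^4*z^5 + V^5*w^3*z^5 + 5*V^4*w^5*z^4 + V^5*w^2*z^5 - 2*V^4*w^5*z^3 + 5*V^4*w^4*z^4 - V^3*w^4*z^5 + V^5*w*z^5 - 2*V^4*w^4*z^3 + 5*V^4*w^3*z^4 + 2*V^4*w^2*z^5 + 8*V^3*w^5*z^3 + 3*V^3*w^4*z^4 - V^3*w^3*z^5 - 2*V^4*w^3*z^3 + 4*V^4*w^2*z^4 + 2*V^4*w*z^5 - 6*V^3*w^5*z^2 + 5*V^3*w^4*z^3 + 3*V^3*w^3*z^4 + V^3*w^2*z^5 - 2*V^2*w^4*z^4 - V^4*w^2*z^3 + 4*V^4*w*z^4 + V^3*w^5*z - 5*V^3*w^4*z^2 + 5*V^3*w^3*z^3 + 8*V^3*w^2*z^4 + V^3*w*z^5 + 4*V^2*w^5*z^2 + 7*V^2*w^4*z^3 - 2*V^2*w^3*z^4 - V^4*w*z^3 + V^3*w^4*z - 5*V^3*w^3*z^2 + V^3*w^2*z^3 + 8*V^3*w*z^4 - 4*V^2*w^5*z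 - 5*V^2*w^4*z^2 + 7*V^2*w^3*z^3 + 4*V^2*w^2*z^4 + V^3*w^3*z - V^3*w^2*z^2 + V^3*w*z^3 + V^2*w^5 + V^2*w^4*z - 5*V^2*w^3*z^2 + 6*V^2*w^2*z^3 + 4*V^2*w*z^4 - V^3*w*z^2 - 2*V^3*z^3 + V^2*w^3*z - 5*V^2*w^2*z^2 + 5*V^2*w*z^3 + 4*V*w^2*z^3 + V^3*z^2 + 3*V^2*w^2*z - 2*V^2*w*z^2 - 4*V^2*z^3 - 4*V*w^2*z^2 + 3*V*w*z^3 - V^2*w^2 + 3*V*w^2*z - V*w*z^2 - 2*V*z^3 + V^2*z - V*w^2 - 3*V*z^2 + 2*V*z - 2*z^2 + z"

definition R_fun :: "'a::{comm_ring_1, inverse} \<Rightarrow> 'a \<Rightarrow> 'a \<Rightarrow> 'a" where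
  "R_fun z V w = ((V*z^2 - z^2 + 3*z - 1) * V * w^2) *
     inverse (V*z^4 - 3*V*z^3 + 3*V*z^2 + z^3 - V*z - 3*z^2 + 3*z - 1)"

end

theory Submission
  imports Defs
begin

text \<open>
  Binary trees encode Dyck paths by first-return decomposition. In these terms \<open>S \<le> Node Q\<^sub>1 Q\<^sub>2\<close> holds
  iff \<open>S = Node A (B P\<^sub>2)\<close> with \<open>AB \<le> Q\<^sub>1\<close> and \<open>P\<^sub>2 \<le> Q\<^sub>2\<close>, so an interval is a pair of smaller
  intervals with a contact of the first lower path. This gives a functional equation for the series
  \<open>F(x)\<close> of intervals counted by contacts, and a linear one, with catalytic variables \<open>x\<close>, \<open>y\<close>, for
  the series \<open>M(x, y)\<close> of intervals with a marked up-step, where \<open>x\<close> and \<open>y\<close> count the contacts before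
  and after that step. With \<open>X = (1 + U) / (1 + zU)\<^sup>2\<close> one has
  \<open>F(X) = (1 + zU)(1 - 2z - z\<^sup>2U) / (1 - z)\<^sup>3\<close>. If \<open>Y\<close> is the same function of \<open>V\<close>, the coefficients of
  \<open>M(X, Y)\<close> and \<open>M(1, Y)\<close> both vanish as soon as \<open>U\<close>, \<open>V\<close> satisfy two polynomial equations, quadratic
  in \<open>U\<close>, whose resultant is a multiple of \<open>S(V, z, w)\<close>. What remains of the equation is \<open>M(1, 1) = R(z, V)\<close>.
\<close>

section \<open>Dyck paths, trees and the Tamari order\<close>

lemma ht_simps [simp]:
  "ht [] = 0" "ht (True # xs) = ht xs + 1" "ht (False # xs) = ht xs - 1"
  "ht (xs @ ys) = ht xs + ht ys"
  by (simp_all add: ht_def)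

lemma nonneg_path_iff_prefix:
  "nonneg_path xs \<longleftrightarrow> (\<forall>ys zs. xs = ys @ zs \<longrightarrow> 0 \<le> ht ys)"
proof
  assume "nonneg_path xs"
  then show "\<forall>ys zs. xs = ys @ zs \<longrightarrow> 0 \<le> ht ys"
    unfolding nonneg_path_def by (metis append_eq_conv_conj length_append le_add1)
next
  assume "\<forall>ys zs. xs = ys @ zs \<longrightarrow> 0 \<le> ht ys"
  then show "nonneg_path xs"
    unfolding nonneg_path_def by (metis append_take_drop_id)
qed

lemma nonneg_path_prefix: "nonneg_path (xs @ ys) \<Longrightarrow> 0 \<le> ht xs"
  by (auto simp: nonneg_path_iff_prefix)

definition balanced :: "bool list \<Rightarrow> bool" where
  "balanced xs \<longleftrightarrow> nonneg_path xs \<and> ht xs = 0"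

lemma balanced_prefix: "balanced (xs @ ys) \<Longrightarrow> 0 \<le> ht xs"
  by (auto simp: balanced_def nonneg_path_prefix)

lemma balanced_suffix:
  assumes "balanced (xs @ ys)" "ht xs = 0"
  shows "balanced ys"
  unfolding balanced_def nonneg_path_iff_prefix
proof (intro conjI allI impI)
  show "ht ys = 0" using assms by (simp add: balanced_def)
  fix us vs assume "ys = us @ vs"
  then have "0 \<le> ht (xs @ us)" using assms(1) balanced_prefix[of "xs @ us" vs] by simp
  then show "0 \<le> ht us" using assms(2) by simp
qed

section \<open>Dyck words as words of binary trees\<close>

datatype btree = Leaf | Node btree btree

text \<open>\<open>Node l r\<close> encodes the first-return decomposition u l d r.\<close>

primrec word :: "btree \<Rightarrow> bool list" where
  "word Leaf = []"
| "word (Node l r) = True # word l @ False # word r"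

lemma ht_word [simp]: "ht (word T) = 0"
  by (induction T) auto

lemma length_word: "length (word T) = 2 * size T"
  by (induction T) auto

lemma count_word: "count_list (word T) True = size T"
  by (induction T) auto

text \<open>The trailing \<open>xs\<close> serves the induction: the word of a left subtree is
  always followed by a down-step and further steps.\<close>

lemma word_prefix_nonneg: "word T @ xs = ys @ zs \<Longrightarrow> length ys \<le> length (word T) \<Longrightarrow> 0 \<le> ht ys"
proof (induction T arbitrary: xs ys zs)
  case Leaf
  then show ?case by simp
next
  case (Node l r)
  show ?case
  proof (cases ys)
    case Nil
    then show ?thesis by simp
  next
    case (Cons a ys')
    with Node.prems have a: "a = True" and e: "word l @ False # word r @ xs = ys' @ zs" by auto
    show ?thesis
    proof (cases "length ys' \<le> length (word l)")
      case True
      from Node.IH(1)[OF e True] show ?thesis by (simp add: Cons a)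
    next
      case False
      then obtain ys'' where ys': "ys' = word l @ False # ys''" and e': "word r @ xs = ys'' @ zs"
        using e by (auto simp: append_eq_append_conv2 Cons_eq_append_conv)
      have "length ys'' \<le> length (word r)" using Node.prems(2) by (simp add: Cons ys')
      from Node.IH(2)[OF e' this] show ?thesis by (simp add: Cons a ys')
    qed
  qed
qed

lemma balanced_word: "balanced (word T)"
  unfolding balanced_def nonneg_path_iff_prefix
  using word_prefix_nonneg[of T "[]"] by auto

text \<open>Cut at the first step that goes below the axis. After an initial up-step the remaining
  steps have height at most -2, so they can be cut twice, which gives the two subtrees.\<close>

lemma negative_splits_word:
  "ht xs < 0 \<Longrightarrow> \<exists>T r. xs = word T @ False # r"
proof (induction xs rule: length_induct)
  case (1 xs)
  show ?case
  proof (cases xs)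
    case Nil
    with 1 show ?thesis by simp
  next
    case (Cons a ys)
    show ?thesis
    proof (cases a)
      case False
      then show ?thesis using Cons by (intro exI[of _ Leaf]) auto
    next
      case True
      then have "ht ys < 0" using 1 Cons by simp
      then obtain T r where ys: "ys = word T @ False # r" using 1 Cons by auto
      then have "ht r < 0" using 1 Cons True by simp
      then obtain T' r' where "r = word T' @ False # r'" using 1 Cons ys by fastforce
      then have "xs = word (Node T T') @ False # r'" using Cons True ys by simp
      then show ?thesis by blast
    qed
  qed
qed

lemma balanced_imp_word: "balanced xs \<Longrightarrow> \<exists>T. word T = xs"
proof (induction xs rule: length_induct)
  case (1 xs)
  show ?case
  proof (cases xs)
    case Nil
    then show ?thesis by (intro exI[of _ Leaf]) simp
  next
    case (Cons a ys)
    have "0 \<le> ht [a]" using 1 Cons balanced_prefix[of "[a]" ys] by simp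
    then have a: "a = True" by (cases a) auto
    then have "ht ys < 0" using 1 Cons by (simp add: balanced_def)
    then obtain T r where ys: "ys = word T @ False # r" using negative_splits_word by blast
    have "balanced r"
      using 1 balanced_suffix[of "True # word T @ [False]" r] by (simp add: Cons ys a)
    then obtain T' where "word T' = r" using 1 Cons ys by fastforce
    then have "word (Node T T') = xs" using Cons ys a by simp
    then show ?thesis by blast
  qed
qed

lemma balanced_iff_word: "balanced xs \<longleftrightarrow> (\<exists>T. word T = xs)"
  using balanced_word balanced_imp_word by auto

text \<open>The down-step after a tree word is the first one to go below the axis, so it marks where
  the word ends; this gives unique readability.\<close>

lemma word_False_cancel:
  "word S @ False # xs = word T @ False # ys \<Longrightarrow> S = T \<and> xs = ys"
proof (induction S arbitrary: T xs ys)
  case Leaf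
  then show ?case by (cases T) auto
next
  case (Node l r)
  obtain l' r' where T: "T = Node l' r'" using Node.prems by (cases T) auto
  then have "word l @ False # (word r @ False # xs) = word l' @ False # (word r' @ False # ys)"
    using Node.prems by simp
  from Node.IH(1)[OF this] have "l = l'" "word r @ False # xs = word r' @ False # ys" by auto
  with Node.IH(2) T show ?case by blast
qed

lemma inj_word: "inj word"
  using word_False_cancel[of _ "[]" _ "[]"] by (auto intro: injI)

lemma dyck_iff_word: "dyck n P \<longleftrightarrow> (\<exists>T. size T = n \<and> word T = P)"
proof
  assume "dyck n P"
  then have "balanced P" and n: "count_list P True = n"
    by (auto simp: dyck_def balanced_def)
  then obtain T where "word T = P" using balanced_imp_word by blast
  then show "\<exists>T. size T = n \<and> word T = P" using n by (auto simp: count_word)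
next
  assume "\<exists>T. size T = n \<and> word T = P"
  then obtain T where "size T = n" "word T = P" by blast
  then show "dyck n P" using balanced_word[of T]
    by (auto simp: dyck_def balanced_def length_word count_word)
qed

lemma finite_size_eq: "finite {T :: btree. size T = n}"
proof -
  have "word ` {T. size T = n} \<subseteq> {xs. set xs \<subseteq> UNIV \<and> length xs = 2 * n}"
    by (auto simp: length_word)
  then have "finite (word ` {T. size T = n})"
    by (rule finite_subset) (rule finite_lists_length_eq, simp)
  then show ?thesis
    by (rule finite_imageD) (rule inj_on_subset[OF inj_word], simp)
qed

section \<open>Concatenation of trees along the right spine\<close>

primrec app :: "btree \<Rightarrow> btree \<Rightarrow> btree" where
  "app Leaf s = s"
| "app (Node l r) s = Node l (app r s)"

lemma app_assoc: "app (app a b) c = app a (app b c)"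
  by (induction a) auto

lemma app_Leaf [simp]: "app a Leaf = a"
  by (induction a) auto

lemma word_app [simp]: "word (app a b) = word a @ word b"
  by (induction a) auto

lemma size_app [simp]: "size (app a b) = size a + size b"
  by (induction a) auto

lemma app_cancel: "app a b = app a' b' \<Longrightarrow> size a = size a' \<Longrightarrow> a = a' \<and> b = b'"
proof (induction a arbitrary: a')
  case Leaf
  then show ?case by (cases a') auto
next
  case (Node l r)
  then show ?case by (cases a') auto
qed

lemma prime_excursion_iff_word: "prime_excursion e \<longleftrightarrow> (\<exists>T. e = word (Node T Leaf))"
  using balanced_iff_word by (auto simp: prime_excursion_def balanced_def)

lemma prime_excursion_prefix_pos:
  assumes "prime_excursion (us @ vs)" "us \<noteq> []" "vs \<noteq> []"
  shows "0 < ht us"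
proof -
  obtain e where e: "us @ vs = True # e @ [False]" "balanced e"
    using assms(1) by (auto simp: prime_excursion_def balanced_def)
  obtain us' where us: "us = True # us'" using assms(2) e(1) by (cases us) auto
  have "us' @ vs = e @ [False]" using e(1) us by simp
  then have "us' @ butlast vs = e" using assms(3)
    by (metis butlast_append butlast_snoc)
  then show ?thesis using balanced_prefix e(2) us by fastforce
qed

section \<open>Tamari steps in context and below a given root\<close>

lemma tamari_step_context: "tamari_step P Q \<Longrightarrow> tamari_step (xs @ P @ ys) (xs @ Q @ ys)"
  unfolding tamari_step_def by (metis append.assoc)

lemma tamari_le_context: "tamari_le P Q \<Longrightarrow> tamari_le (xs @ P @ ys) (xs @ Q @ ys)"
  unfolding tamari_le_def
proof (induction rule: rtranclp_induct)
  case base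
  show ?case by simp
next
  case (step Q R)
  then show ?case using tamari_step_context by (metis rtranclp.rtrancl_into_rtrancl)
qed

lemma tamari_le_refl [simp]: "tamari_le P P"
  by (simp add: tamari_le_def)

lemma tamari_le_trans: "tamari_le P Q \<Longrightarrow> tamari_le Q R \<Longrightarrow> tamari_le P R"
  by (simp add: tamari_le_def)

lemma tamari_step_length: "tamari_step P Q \<Longrightarrow> length P = length Q"
  by (auto simp: tamari_step_def)

lemma tamari_le_length: "tamari_le P Q \<Longrightarrow> length P = length Q"
  unfolding tamari_le_def by (induction rule: rtranclp_induct) (auto dest: tamari_step_length)

text \<open>In \<open>Q\<close> the down-step after \<open>e\<close> ends at height at least 0, so
  \<open>A\<close> ends at height at least 1. This pays for the down-step that \<open>P\<close>
  takes before \<open>e\<close>.\<close>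

lemma tamari_step_balanced:
  assumes "tamari_step P Q" "balanced Q"
  shows "balanced P"
proof -
  obtain A e B where P: "P = A @ False # e @ B" and Q: "Q = A @ e @ False # B"
    and e: "prime_excursion e"
    using assms(1) by (auto simp: tamari_step_def)
  have he: "balanced e" using e prime_excursion_iff_word balanced_word by metis
  then have he0: "ht e = 0" by (simp add: balanced_def)
  have A1: "1 \<le> ht A" using balanced_prefix[of "A @ e @ [False]" B] assms(2) Q he0 by simp
  have "0 \<le> ht us" if us: "P = us @ vs" for us vs
  proof -
    have *: "us @ vs = A @ False # e @ B" using us P by simp
    consider (A) ws where "A = us @ ws"
      | (e) ws ws' where "us = A @ False # ws" "e = ws @ ws'"
      | (B) ws where "us = A @ False # e @ ws" "B = ws @ vs"
      using * by (auto simp: append_eq_append_conv2 append_eq_Cons_conv)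
    then show ?thesis
    proof cases
      case A
      then show ?thesis using balanced_prefix assms(2) Q by (metis append.assoc)
    next
      case e
      then show ?thesis using A1 he balanced_prefix by fastforce
    next
      case B
      have "0 \<le> ht (A @ e @ False # ws)"
        using B balanced_prefix[of "A @ e @ False # ws" vs] assms(2) Q by simp
      then show ?thesis using B by simp
    qed
  qed
  then show ?thesis using assms(2) P Q by (simp add: balanced_def nonneg_path_iff_prefix)
qed

text \<open>An excursion cannot straddle the end of a balanced prefix: it starts at height at least
  0 and stays strictly higher inside, whereas the prefix ends at height 0.\<close>

lemma excursion_split:
  assumes eq: "C @ e @ E = A @ T" and e: "prime_excursion e" and A: "balanced A"
  obtains (left) A' where "A = C @ e @ A'" "E = A' @ T"
    | (right) C' where "C = A @ C'" "T = C' @ e @ E"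
proof -
  consider (1) us where "C = A @ us" "us @ e @ E = T" | (2) us where "A = C @ us" "e @ E = us @ T"
    using eq by (auto simp: append_eq_append_conv2)
  then show thesis
  proof cases
    case 1
    then show ?thesis using right by auto
  next
    case 2
    consider (a) vs where "us = e @ vs" "E = vs @ T" | (b) vs where "e = us @ vs" "vs @ E = T"
      using 2(2) by (auto simp: append_eq_append_conv2)
    then show ?thesis
    proof cases
      case a
      then show ?thesis using left 2 by auto
    next
      case b
      show ?thesis
      proof (cases "us = [] \<or> vs = []")
        case True
        then show ?thesis
        proof
          assume "us = []"
          then show ?thesis using right[of "[]"] 2 by simp
        next
          assume "vs = []"
          then show ?thesis using left[of "[]"] 2 b by simp
        qed
      next
        case False
        then have "0 < ht us" using prime_excursion_prefix_pos e b by blast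
        moreover have "0 \<le> ht C" using balanced_prefix A 2 by blast
        ultimately show ?thesis using A 2 by (simp add: balanced_def)
      qed
    qed
  qed
qed

text \<open>In the upper path the exchanged excursion \<open>e\<close> lies wholly inside
  \<open>a\<close>, \<open>b\<close> or \<open>r\<close>, and undoing the step takes place inside
  that factor. The exception is an \<open>e\<close> that ends \<open>a\<close>: the moved down-step
  is then the one closing the root, and \<open>e\<close> passes from \<open>a\<close> to
  \<open>b\<close> while \<open>app a b\<close> stays the same.\<close>

lemma tamari_step_into_Node:
  assumes "tamari_step P (word (Node a (app b r)))"
  obtains a' b' r' where "P = word (Node a' (app b' r'))"
    "tamari_le (word (app a' b')) (word (app a b))" "tamari_le (word r') (word r)"
proof -
  obtain C e E where P: "P = C @ False # e @ E" and e: "prime_excursion e"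
    and R: "C @ e @ False # E = True # word a @ False # word b @ word r"
    using assms by (auto simp: tamari_step_def)
  have step: "tamari_step (A @ False # e @ B) (A @ e @ False # B)" for A B
    using e by (auto simp: tamari_step_def)
  have down: "\<exists>t. word t = A @ False # e @ B" if "balanced (A @ e @ False # B)" for A B
    using tamari_step_balanced[OF step that] balanced_imp_word by blast
  have stepI: "tamari_le p q" if "tamari_step p q" for p q
    using that by (auto simp: tamari_le_def)
  obtain t where t: "e = True # word t @ [False]"
    using e prime_excursion_iff_word by auto
  \<comment> \<open>Otherwise \<open>e\<close> would be the whole first-return factor, and the
    down-step after it would begin a Dyck word.\<close>
  have "C \<noteq> []"
  proof
    assume "C = []"
    then have "word t @ False # False # E = word a @ False # word b @ word r"
      using R t by simp
    then have "False # E = word (app b r)" by (auto dest: word_False_cancel)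
    then show False by (cases "app b r") auto
  qed
  then obtain C' where C: "C = True # C'" and R': "C' @ e @ False # E = word a @ False # word b @ word r"
    using R by (cases C) auto
  from R' e balanced_word[of a] show thesis
  proof (cases rule: excursion_split)
    case (left A')
    show thesis
    proof (cases A')
      case Nil
      have "ht C' = 0" using ht_word[of a] left(1) t Nil by simp
      moreover have "nonneg_path C'"
        using balanced_word[of a] unfolding left(1) balanced_def nonneg_path_iff_prefix
        by simp
      ultimately obtain c where c: "word c = C'" using balanced_imp_word balanced_def by blast
      have "P = word (Node c (app (Node t b) r))" using left Nil C c t P by simp
      moreover have "word (app c (Node t b)) = word (app a b)" using left(1) Nil c t by simp
      ultimately show thesis using that tamari_le_refl by metis
    next
      case (Cons x A2)
      then have A': "A' = False # A2" and E: "E = A2 @ False # word b @ word r" using left(2) by auto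
      obtain a' where a': "word a' = C' @ False # e @ A2"
        using down[of C' A2] balanced_word[of a] left(1) A' by auto
      have s: "tamari_step (word a') (word a)" using step a' left(1) A' by metis
      have "tamari_le (word (app a' b)) (word (app a b))"
        using stepI[OF tamari_step_context[OF s, of "[]" "word b"]] by simp
      moreover have "P = word (Node a' (app b r))" using P C E a' by simp
      ultimately show thesis using that tamari_le_refl by blast
    qed
  next
    case (right C3)
    have "C3 \<noteq> []" using right(2) t by auto
    then obtain C4 where C3: "C3 = False # C4" and R4: "C4 @ e @ False # E = word b @ word r"
      using right(2) by (cases C3) auto
    from R4 e balanced_word[of b] show thesis
    proof (cases rule: excursion_split)
      case (left B')
      show thesis
      proof (cases B')
        case Nil
        then show thesis using left(2) by (cases r) auto
      next
        case (Cons x B2)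
        then have B': "B' = False # B2" and E: "E = B2 @ word r" using left(2) by auto
        obtain b' where b': "word b' = C4 @ False # e @ B2"
          using down[of C4 B2] balanced_word[of b] left(1) B' by auto
        have s: "tamari_step (word b') (word b)" using step b' left(1) B' by metis
        have "tamari_le (word (app a b')) (word (app a b))"
          using stepI[OF tamari_step_context[OF s, of "word a" "[]"]] by simp
        moreover have "P = word (Node a (app b' r))" using P C E b' right(1) C3 by simp
        ultimately show thesis using that tamari_le_refl by blast
      qed
    next
      case (right C5)
      obtain r' where r': "word r' = C5 @ False # e @ E"
        using down[of C5 E] balanced_word[of r] right(2) by metis
      have s: "tamari_step (word r') (word r)" using step r' right(2) by metis
      have "P = word (Node a (app b r'))" using P C r' right(1) C3 \<open>C' = word a @ C3\<close> by simp
      then show thesis using that stepI[OF s] tamari_le_refl by blast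
    qed
  qed
qed

definition tle :: "btree \<Rightarrow> btree \<Rightarrow> bool" where
  "tle S T \<longleftrightarrow> tamari_le (word S) (word T)"

lemma tle_size: "tle S T \<Longrightarrow> size S = size T"
  using tamari_le_length by (fastforce simp: tle_def length_word)

lemma tle_trans: "tle S T \<Longrightarrow> tle T U \<Longrightarrow> tle S U"
  unfolding tle_def by (rule tamari_le_trans)

text \<open>The down-step closing the root moves past \<open>b\<close> one excursion at a
  time.\<close>

lemma tle_rotate: "tle (Node a (app b r)) (Node (app a b) r)"
proof (induction b arbitrary: a)
  case Leaf
  then show ?case by (simp add: tle_def)
next
  case (Node t b)
  have "tamari_step (word (Node a (app (Node t b) r))) (word (Node (app a (Node t Leaf)) (app b r)))"
    unfolding tamari_step_def
    by (rule exI[of _ "True # word a"], rule exI[of _ "word (Node t Leaf)"],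
        rule exI[of _ "word b @ word r"]) (auto simp: prime_excursion_iff_word)
  then have "tle (Node a (app (Node t b) r)) (Node (app a (Node t Leaf)) (app b r))"
    by (auto simp: tle_def tamari_le_def)
  with Node.IH[of "app a (Node t Leaf)"] show ?case by (auto simp: app_assoc intro: tle_trans)
qed

text \<open>From right to left, rotate and then enlarge the two factors in context. From left to
  right, follow the chain of steps downwards from \<open>Node q1 q2\<close>, where the shape holds
  with \<open>b = Leaf\<close>; every step preserves it.\<close>

lemma tle_Node_iff:
  "tle S (Node q1 q2) \<longleftrightarrow> (\<exists>a b p2. S = Node a (app b p2) \<and> tle (app a b) q1 \<and> tle p2 q2)"
proof
  assume "\<exists>a b p2. S = Node a (app b p2) \<and> tle (app a b) q1 \<and> tle p2 q2"
  then obtain a b p2 where S: "S = Node a (app b p2)" and 1: "tle (app a b) q1" and 2: "tle p2 q2"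
    by blast
  have "tle (Node (app a b) p2) (Node q1 p2)"
    using tamari_le_context[OF 1[unfolded tle_def], of "[True]" "False # word p2"] by (simp add: tle_def)
  moreover have "tle (Node q1 p2) (Node q1 q2)"
    using tamari_le_context[OF 2[unfolded tle_def], of "True # word q1 @ [False]" "[]"] by (simp add: tle_def)
  ultimately show "tle S (Node q1 q2)" using S tle_rotate tle_trans by blast
next
  assume "tle S (Node q1 q2)"
  then have "tamari_step\<^sup>*\<^sup>* (word S) (word (Node q1 q2))" by (simp add: tle_def tamari_le_def)
  then have "\<exists>a b p2. word S = word (Node a (app b p2)) \<and> tle (app a b) q1 \<and> tle p2 q2"
  proof (induction "word S" arbitrary: S rule: converse_rtranclp_induct)
    case base
    have "word (Node q1 q2) = word (Node q1 (app Leaf q2)) \<and> tle (app q1 Leaf) q1 \<and> tle q2 q2"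
      by (simp add: tle_def)
    then show ?case using base by metis
  next
    case (step R)
    \<comment> \<open>Balancedness passes down the chain, so the intermediate path is the word of a
      tree.\<close>
    have "balanced (word (Node q1 q2))" by (rule balanced_word)
    with step.hyps(2) have "balanced R"
      by (induction rule: converse_rtranclp_induct) (auto dest: tamari_step_balanced)
    then obtain T where T: "R = word T" using balanced_imp_word by metis
    then obtain a b p2 where R: "R = word (Node a (app b p2))" and 1: "tle (app a b) q1" and 2: "tle p2 q2"
      using step.hyps(3) by blast
    obtain a' b' r' where "word S = word (Node a' (app b' r'))" "tle (app a' b') (app a b)" "tle r' p2"
      using tamari_step_into_Node[OF step.hyps(1)[unfolded R]] unfolding tle_def by metis
    then show ?case using 1 2 tle_trans by blast
  qed
  then show "\<exists>a b p2. S = Node a (app b p2) \<and> tle (app a b) q1 \<and> tle p2 q2"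
    using inj_word by (metis injD)
qed

section \<open>Recursive decomposition of Tamari intervals\<close>

primrec splits :: "btree \<Rightarrow> (btree \<times> btree) set" where
  "splits Leaf = {(Leaf, Leaf)}"
| "splits (Node l r) = insert (Leaf, Node l r) (map_prod (Node l) id ` splits r)"

lemma splits_iff: "(a, b) \<in> splits t \<longleftrightarrow> app a b = t"
proof (induction t arbitrary: a b)
  case Leaf
  then show ?case by (cases a) auto
next
  case (Node l r)
  then show ?case by (cases a) (auto simp: image_iff intro!: bexI[of _ "(_, b)"])
qed

lemma finite_splits [simp]: "finite (splits t)"
  by (induction t) auto

lemma sum_splits_Node:
  "(\<Sum>(a, b)\<in>splits (Node l r). f a b) = f Leaf (Node l r) + (\<Sum>(a, b)\<in>splits r. f (Node l a) b)"
proof -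
  have "inj_on (map_prod (Node l) id) (splits r)" by (auto intro!: inj_onI)
  then show ?thesis
    by (simp, subst sum.insert) (auto simp: sum.reindex case_prod_unfold)
qed

section \<open>Intervals between trees and their decomposition\<close>

definition tree_intervals :: "nat \<Rightarrow> (btree \<times> btree) set" where
  "tree_intervals n = {(S, T). size S = n \<and> size T = n \<and> tle S T}"

lemma finite_tree_intervals [simp]: "finite (tree_intervals n)"
  by (rule finite_subset[of _ "{T. size T = n} \<times> {T. size T = n}"])
     (auto simp: tree_intervals_def finite_size_eq)

lemma tree_intervals_0 [simp]: "tree_intervals 0 = {(Leaf, Leaf)}"
proof -
  have "size T = 0 \<longleftrightarrow> T = Leaf" for T :: btree by (cases T) auto
  then have "tree_intervals 0 = {(S, T). S = Leaf \<and> T = Leaf \<and> tle S T}"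
    unfolding tree_intervals_def by (metis (no_types, lifting))
  then show ?thesis unfolding tle_def by auto
qed

lemma sum_intervals:
  "(\<Sum>(P, Q)\<in>intervals n. f P Q) = (\<Sum>(S, T)\<in>tree_intervals n. f (word S) (word T))"
proof -
  have "bij_betw (map_prod word word) (tree_intervals n) (intervals n)"
    unfolding bij_betw_def
  proof
    show "inj_on (map_prod word word) (tree_intervals n)"
      using inj_word by (auto intro!: inj_onI dest: injD)
    show "map_prod word word ` tree_intervals n = intervals n"
      by (force simp: tree_intervals_def intervals_def dyck_iff_word tle_def)
  qed
  from sum.reindex_bij_betw[OF this, of "\<lambda>(P, Q). f P Q"] show ?thesis
    by (simp add: case_prod_unfold)
qed

text \<open>\<open>tle_Node_iff\<close> turned into a bijection. The decomposition is unique because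
  \<open>size Q1\<close> is the size of \<open>app a b\<close>, which for known \<open>a\<close>
  fixes where \<open>app b P2\<close> is cut.\<close>

lemma sum_tree_intervals_Suc:
  "(\<Sum>(P, Q)\<in>tree_intervals (Suc n). g P Q) =
   (\<Sum>k\<le>n. \<Sum>(P1, Q1)\<in>tree_intervals k. \<Sum>(P2, Q2)\<in>tree_intervals (n - k). \<Sum>(a, b)\<in>splits P1.
      g (Node a (app b P2)) (Node Q1 Q2))"
proof -
  define D where "D = (SIGMA k:{..n}. SIGMA I:tree_intervals k. SIGMA J:tree_intervals (n - k). splits (fst I))"
  define h where "h = (\<lambda>(k::nat, I :: btree \<times> btree, J :: btree \<times> btree, s). (Node (fst s) (app (snd s) (fst J)), Node (snd I) (snd J)) :: btree \<times> btree)"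
  have "bij_betw h D (tree_intervals (Suc n))"
    unfolding bij_betw_def
  proof
    show "inj_on h D"
    proof (rule inj_onI)
      fix x y assume x: "x \<in> D" and y: "y \<in> D" and e: "h x = h y"
      obtain k P1 Q1 P2 Q2 a b where X: "x = (k, (P1, Q1), (P2, Q2), (a, b))"
        by (metis surj_pair)
      obtain k' P1' Q1' P2' Q2' a' b' where Y: "y = (k', (P1', Q1'), (P2', Q2'), (a', b'))"
        by (metis surj_pair)
      have *: "a = a'" "Q1 = Q1'" "Q2 = Q2'" "app b P2 = app b' P2'" using e by (auto simp: X Y h_def)
      moreover have k: "k = size Q1" "k' = size Q1'" "app a b = P1" "app a' b' = P1'" "size P1 = k" "size P1' = k'"
        using x y by (auto simp: D_def X Y tree_intervals_def splits_iff)
      ultimately have "size b = size b'" by auto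
      then have "b = b'" "P2 = P2'" using app_cancel * by blast+
      then show "x = y" using * k by (simp add: X Y)
    qed
    show "h ` D = tree_intervals (Suc n)"
    proof (intro equalityI subsetI)
      fix p assume "p \<in> h ` D"
      then obtain x where x: "x \<in> D" "p = h x" by blast
      obtain k P1 Q1 P2 Q2 a b where X: "x = (k, (P1, Q1), (P2, Q2), (a, b))"
        by (metis surj_pair)
      have *: "k \<le> n" "size P1 = k" "size Q1 = k" "tle P1 Q1" "size P2 = n - k" "size Q2 = n - k" "tle P2 Q2" "app a b = P1"
        using x by (auto simp: D_def X tree_intervals_def splits_iff)
      moreover have "size a + size b = k" using * by auto
      moreover have "tle (Node a (app b P2)) (Node Q1 Q2)" using * by (auto simp: tle_Node_iff)
      ultimately show "p \<in> tree_intervals (Suc n)" by (auto simp: x X h_def tree_intervals_def)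
    next
      fix p assume "p \<in> tree_intervals (Suc n)"
      then obtain S T where p: "p = (S, T)" "size S = Suc n" "size T = Suc n" "tle S T"
        by (auto simp: tree_intervals_def)
      then obtain Q1 Q2 where T: "T = Node Q1 Q2" by (cases T) auto
      then obtain a b P2 where S: "S = Node a (app b P2)" "tle (app a b) Q1" "tle P2 Q2"
        using p tle_Node_iff by blast
      then have "size a + size b = size Q1" "size P2 = size Q2" by (auto dest: tle_size)
      then have "(size Q1, (app a b, Q1), (P2, Q2), (a, b)) \<in> D"
        using S T p by (auto simp: D_def tree_intervals_def splits_iff)
      moreover have "h (size Q1, (app a b, Q1), (P2, Q2), (a, b)) = p" by (simp add: h_def p T S)
      ultimately show "p \<in> h ` D" by (metis image_eqI)
    qed
  qed
  from sum.reindex_bij_betw[OF this, of "\<lambda>(P, Q). g P Q"] show ?thesis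
    by (simp add: D_def h_def sum.Sigma case_prod_unfold)
qed

section \<open>Contacts, and statistics of the up-steps\<close>

primrec contacts :: "btree \<Rightarrow> nat" where
  "contacts Leaf = 0"
| "contacts (Node l r) = Suc (contacts r)"

lemma contacts_app [simp]: "contacts (app a b) = contacts a + contacts b"
  by (induction a) auto

text \<open>The second pieces of the cuts have 0, 1, ..., \<open>contacts t\<close> contacts, once
  each, so the sum is geometric; the factor \<open>x - 1\<close> avoids a division.\<close>

lemma sum_splits_contacts:
  fixes x :: "'a::comm_ring_1"
  shows "(x - 1) * (\<Sum>(a, b)\<in>splits t. x ^ contacts b) = x ^ Suc (contacts t) - 1"
proof (induction t)
  case Leaf
  then show ?case by simp
next
  case (Node l r)
  then show ?case by (simp only: sum_splits_Node) (simp add: algebra_simps)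
qed

text \<open>For the up-steps from left to right: the starting height, and the number of returns to the
  axis before and after the step.\<close>

primrec hgts :: "btree \<Rightarrow> int list" where
  "hgts Leaf = []"
| "hgts (Node l r) = 0 # map ((+) 1) (hgts l) @ hgts r"

primrec befs :: "btree \<Rightarrow> nat list" where
  "befs Leaf = []"
| "befs (Node l r) = replicate (Suc (size l)) 0 @ map Suc (befs r)"

primrec afts :: "btree \<Rightarrow> nat list" where
  "afts Leaf = []"
| "afts (Node l r) = replicate (Suc (size l)) (Suc (contacts r)) @ afts r"

lemma length_stats [simp]: "length (hgts t) = size t" "length (befs t) = size t" "length (afts t) = size t"
  by (induction t) auto

lemma hgts_app: "hgts (app a b) = hgts a @ hgts b"
  by (induction a) auto

lemma befs_app: "befs (app a b) = befs a @ map ((+) (contacts a)) (befs b)"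
  by (induction a) (auto simp: comp_def)

lemma afts_app: "afts (app a b) = map ((+) (contacts b)) (afts a) @ afts b"
  by (induction a) (auto simp: map_replicate_const add.commute)

lemma up_heights_word: "up_heights h (word t @ xs) = map ((+) h) (hgts t) @ up_heights h xs"
  by (induction t arbitrary: h xs) (auto simp: comp_def add.assoc)

lemma tilde_word: "tilde (word t) (Suc i) = hgts t ! i" if "i < size t"
  using that up_heights_word[of 0 t "[]"] by (simp add: tilde_def)

text \<open>For the cuts that leave step \<open>i\<close> in the first piece,
  \<open>contacts b\<close> takes each value from 0 to \<open>afts t ! i - 1\<close> once.\<close>

lemma sum_splits_aft:
  fixes y :: "'a::comm_ring_1"
  assumes "i < size t"
  shows "(y - 1) * (\<Sum>(a, b)\<in>splits t. if i < size a then y ^ contacts b else 0) = y ^ (afts t ! i) - 1"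
  using assms
proof (induction t arbitrary: i)
  case Leaf
  then show ?case by simp
next
  case (Node l r)
  show ?case
  proof (cases "i < Suc (size l)")
    case True
    then have "(\<Sum>(a, b)\<in>splits r. if i < size (Node l a) then y ^ contacts b else 0) = (\<Sum>(a, b)\<in>splits r. y ^ contacts b)"
      by (intro sum.cong) auto
    moreover have "afts (Node l r) ! i = Suc (contacts r)"
      using True by (simp add: nth_append del: replicate_Suc)
    ultimately show ?thesis
      using True sum_splits_contacts[of y r] by (simp only: sum_splits_Node) simp
  next
    case False
    define j where "j = i - Suc (size l)"
    have i: "i = Suc (size l) + j" using False by (simp add: j_def)
    have "j < size r" using Node.prems i by simp
    from Node.IH(2)[OF this] show ?thesis
      by (simp only: sum_splits_Node i) (simp add: nth_append)
  qed
qed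

text \<open>For the cuts that leave step \<open>i\<close> in the second piece,
  \<open>contacts a\<close> takes each value from 0 to \<open>befs t ! i\<close> once; in particular
  the subtraction is never truncated there.\<close>

lemma sum_splits_bef:
  fixes x :: "'a::comm_ring_1"
  assumes "i < size t"
  shows "(x - 1) * (\<Sum>(a, b)\<in>splits t. if i < size a then 0 else x ^ (befs t ! i - contacts a)) = x ^ Suc (befs t ! i) - 1"
  using assms
proof (induction t arbitrary: i)
  case Leaf
  then show ?case by simp
next
  case (Node l r)
  show ?case
  proof (cases "i < Suc (size l)")
    case True
    then have "(\<Sum>(a, b)\<in>splits r. if i < size (Node l a) then 0 else x ^ (befs (Node l r) ! i - contacts (Node l a))) = 0"
      by (intro sum.neutral) auto
    moreover have "befs (Node l r) ! i = 0"
      using True by (simp add: nth_append del: replicate_Suc)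
    ultimately show ?thesis
      using True by (simp only: sum_splits_Node) simp
  next
    case False
    define j where "j = i - Suc (size l)"
    have i: "i = Suc (size l) + j" using False by (simp add: j_def)
    have j: "j < size r" using Node.prems i by simp
    then have b: "befs (Node l r) ! i = Suc (befs r ! j)" by (simp add: i nth_append)
    have *: "(\<Sum>(a, b)\<in>splits r. if i < size (Node l a) then 0 else x ^ (Suc (befs r ! j) - contacts (Node l a)))
      = (\<Sum>(a, b)\<in>splits r. if j < size a then 0 else x ^ (befs r ! j - contacts a))"
      by (intro sum.cong) (auto simp: i)
    from Node.IH(2)[OF j] show ?thesis
      unfolding sum_splits_Node b * by (simp add: i algebra_simps)
  qed
qed

section \<open>Functional equations\<close>

lemma sum_lessThan_add:
  fixes f :: "nat \<Rightarrow> 'a::comm_monoid_add"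
  shows "(\<Sum>i<k + m. f i) = (\<Sum>i<k. f i) + (\<Sum>i<m. f (k + i))"
  by (induction m) (auto simp: add.assoc)

text \<open>An abstract form of i \<mapsto> w^i with integer exponents, usable in a coefficient ring
  that is not a field.\<close>

locale height_weight =
  fixes \<omega> :: "int \<Rightarrow> 'a::comm_ring_1"
  assumes weight_add: "\<omega> (i + j) = \<omega> i * \<omega> j" and weight_0 [simp]: "\<omega> 0 = 1"
begin

definition marked :: "'a \<Rightarrow> 'a \<Rightarrow> btree \<Rightarrow> btree \<Rightarrow> 'a" where
  "marked x y P Q = (\<Sum>i<size P. x ^ (befs P ! i) * y ^ (afts P ! i) * \<omega> (hgts Q ! i - 3 * hgts P ! i))"

text \<open>The root step has height 0 in both paths and all contacts after it. Steps of
  \<open>a\<close> rise by 1 in both paths, which changes the exponent by 1 - 3 = -2; steps of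
  \<open>b\<close> rise by 1 in the upper path only. Steps of \<open>p\<close> get in front of them
  the contact that closes the root and the contacts of \<open>b\<close>.\<close>

lemma marked_Node:
  assumes Q1: "size Q1 = size a + size b" and Q2: "size Q2 = size p"
  shows "marked x y (Node a (app b p)) (Node Q1 Q2) =
    y ^ contacts (Node a (app b p)) +
    (\<Sum>i<size Q1. \<omega> (hgts Q1 ! i - 3 * hgts (app a b) ! i) *
       (if i < size a then \<omega> (-2) * y ^ Suc (contacts b + contacts p)
        else \<omega> 1 * x ^ Suc (befs (app a b) ! i - contacts a) * y ^ (afts (app a b) ! i + contacts p))) +
    x ^ Suc (contacts b) * marked x y p Q2"
proof -
  let ?P = "Node a (app b p)" and ?Q = "Node Q1 Q2"
  define f where "f i = x ^ (befs ?P ! i) * y ^ (afts ?P ! i) * \<omega> (hgts ?Q ! i - 3 * hgts ?P ! i)" for i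
  have "marked x y ?P ?Q = (\<Sum>i<Suc (size Q1 + size p). f i)"
    unfolding marked_def f_def by (simp add: Q1 add.assoc)
  also have "\<dots> = f 0 + (\<Sum>i<size Q1. f (Suc i)) + (\<Sum>i<size p. f (Suc (size Q1 + i)))"
    by (subst sum.lessThan_Suc_shift, subst sum_lessThan_add) (simp add: add.assoc)
  also have "f 0 = y ^ contacts ?P"
    by (simp add: f_def)
  also have "(\<Sum>i<size p. f (Suc (size Q1 + i))) = x ^ Suc (contacts b) * marked x y p Q2"
    unfolding marked_def sum_distrib_left
  proof (rule sum.cong[OF refl])
    fix i assume "i \<in> {..<size p}"
    then have i: "i < size p" by simp
    have "befs ?P ! Suc (size Q1 + i) = Suc (contacts b + befs p ! i)"
         "afts ?P ! Suc (size Q1 + i) = afts p ! i" "hgts ?P ! Suc (size Q1 + i) = hgts p ! i"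
         "hgts ?Q ! Suc (size Q1 + i) = hgts Q2 ! i"
      using i Q2 by (simp_all add: Q1 befs_app afts_app hgts_app nth_append)
    then show "f (Suc (size Q1 + i)) = x ^ Suc (contacts b) * (x ^ (befs p ! i) * y ^ (afts p ! i) * \<omega> (hgts Q2 ! i - 3 * hgts p ! i))"
      by (simp add: f_def power_add mult_ac)
  qed
  also have "(\<Sum>i<size Q1. f (Suc i)) = (\<Sum>i<size Q1. \<omega> (hgts Q1 ! i - 3 * hgts (app a b) ! i) *
       (if i < size a then \<omega> (-2) * y ^ Suc (contacts b + contacts p)
        else \<omega> 1 * x ^ Suc (befs (app a b) ! i - contacts a) * y ^ (afts (app a b) ! i + contacts p)))"
  proof (rule sum.cong[OF refl])
    fix i assume "i \<in> {..<size Q1}"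
    then have i: "i < size Q1" by simp
    have hQ: "hgts ?Q ! Suc i = 1 + hgts Q1 ! i" using i by (simp add: nth_append)
    show "f (Suc i) = \<omega> (hgts Q1 ! i - 3 * hgts (app a b) ! i) *
       (if i < size a then \<omega> (-2) * y ^ Suc (contacts b + contacts p)
        else \<omega> 1 * x ^ Suc (befs (app a b) ! i - contacts a) * y ^ (afts (app a b) ! i + contacts p))"
    proof (cases "i < size a")
      case True
      have 1: "befs ?P ! Suc i = 0" "afts ?P ! Suc i = Suc (contacts b + contacts p)"
           "hgts ?P ! Suc i = 1 + hgts (app a b) ! i"
        using True by (simp_all add: nth_append hgts_app)
      have 2: "1 + hgts Q1 ! i - 3 * (1 + hgts (app a b) ! i) = (hgts Q1 ! i - 3 * hgts (app a b) ! i) + (- 2)"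
        by simp
      show ?thesis unfolding f_def 1 hQ 2 weight_add using True by (simp add: mult_ac)
    next
      case False
      define j where "j = i - size a"
      have ij: "i = size a + j" and j: "j < size b" using False i Q1 by (simp_all add: j_def)
      have 1: "befs ?P ! Suc i = Suc (befs (app a b) ! i - contacts a)"
           "afts ?P ! Suc i = afts (app a b) ! i + contacts p"
           "hgts ?P ! Suc i = hgts (app a b) ! i"
        using j by (simp_all add: ij befs_app afts_app hgts_app nth_append)
      have 2: "1 + hgts Q1 ! i - 3 * hgts (app a b) ! i = (hgts Q1 ! i - 3 * hgts (app a b) ! i) + 1"
        by simp
      show ?thesis unfolding f_def 1 hQ 2 weight_add using False by (simp add: mult_ac)
    qed
  qed
  finally show ?thesis .
qed

text \<open>The last three terms come from the marked steps of \<open>P\<close> before the cut,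
  those of \<open>P\<close> after the cut, and those of \<open>p\<close>.\<close>

lemma sum_splits_marked_Node:
  assumes P: "size Q1 = size P" and Q2: "size Q2 = size p"
  shows "(x - 1) * (y - 1) * (\<Sum>(a, b)\<in>splits P. marked x y (Node a (app b p)) (Node Q1 Q2)) =
    (x - 1) * (y - 1) * (\<Sum>(a, b)\<in>splits P. y ^ contacts (Node a (app b p))) +
    \<omega> (-2) * (x - 1) * y * ((marked 1 y P Q1 - marked 1 1 P Q1) * y ^ contacts p) +
    \<omega> 1 * (y - 1) * x * ((x * marked x y P Q1 - marked 1 y P Q1) * y ^ contacts p) +
    (y - 1) * x * ((x * x ^ contacts P - 1) * marked x y p Q2)"
proof -
  define q where "q i = \<omega> (hgts Q1 ! i - 3 * hgts P ! i)" for i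
  define c where "c = contacts p"
  define g where "g i a b = q i *
       (if i < size a then \<omega> (-2) * y ^ Suc (contacts b + c)
        else \<omega> 1 * x ^ Suc (befs P ! i - contacts a) * y ^ (afts P ! i + c))" for i a b
  have "(\<Sum>(a, b)\<in>splits P. marked x y (Node a (app b p)) (Node Q1 Q2)) =
    (\<Sum>(a, b)\<in>splits P. y ^ contacts (Node a (app b p)) + (\<Sum>i<size P. g i a b) + x ^ Suc (contacts b) * marked x y p Q2)"
  proof (rule sum.cong[OF refl], clarify)
    fix a b assume "(a, b) \<in> splits P"
    then have ab: "app a b = P" by (simp add: splits_iff)
    then have "size Q1 = size a + size b" using P by auto
    from marked_Node[OF this Q2, of x y]
    show "marked x y (Node a (app b p)) (Node Q1 Q2) =
       y ^ contacts (Node a (app b p)) + (\<Sum>i<size P. g i a b) + x ^ Suc (contacts b) * marked x y p Q2"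
      unfolding ab P g_def q_def c_def .
  qed
  also have "\<dots> = (\<Sum>(a, b)\<in>splits P. y ^ contacts (Node a (app b p))) + (\<Sum>i<size P. \<Sum>(a, b)\<in>splits P. g i a b)
      + (\<Sum>(a, b)\<in>splits P. x ^ contacts b) * (x * marked x y p Q2)"
    by (subst sum.swap) (simp add: case_prod_unfold sum.distrib sum_distrib_left sum_distrib_right mult_ac)
  finally have 1: "(\<Sum>(a, b)\<in>splits P. marked x y (Node a (app b p)) (Node Q1 Q2)) = \<dots>" .
  \<comment> \<open>For a fixed step, the cuts after it give a geometric sum in \<open>y\<close> and
    the cuts before it one in \<open>x\<close>.\<close>
  have 2: "(x - 1) * (y - 1) * (\<Sum>(a, b)\<in>splits P. g i a b) =
      \<omega> (-2) * (x - 1) * y * (y ^ (afts P ! i) * q i - q i) * y ^ c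
      + \<omega> 1 * (y - 1) * x * (x * (x ^ (befs P ! i) * y ^ (afts P ! i) * q i) - y ^ (afts P ! i) * q i) * y ^ c"
    if "i < size P" for i
  proof -
    have "(\<Sum>(a, b)\<in>splits P. g i a b) =
       \<omega> (-2) * y * q i * y ^ c * (\<Sum>(a, b)\<in>splits P. if i < size a then y ^ contacts b else 0) +
       \<omega> 1 * x * y ^ (afts P ! i) * q i * y ^ c * (\<Sum>(a, b)\<in>splits P. if i < size a then 0 else x ^ (befs P ! i - contacts a))"
      unfolding g_def sum_distrib_left sum.distrib[symmetric]
      by (rule sum.cong) (auto simp: power_add mult_ac)
    also have "(x - 1) * (y - 1) * \<dots> =
       \<omega> (-2) * (x - 1) * y * q i * y ^ c * ((y - 1) * (\<Sum>(a, b)\<in>splits P. if i < size a then y ^ contacts b else 0)) +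
       \<omega> 1 * (y - 1) * x * y ^ (afts P ! i) * q i * y ^ c * ((x - 1) * (\<Sum>(a, b)\<in>splits P. if i < size a then 0 else x ^ (befs P ! i - contacts a)))"
      by (simp add: algebra_simps)
    finally show ?thesis
      unfolding sum_splits_aft[OF that] sum_splits_bef[OF that]
      by (simp add: algebra_simps)
  qed
  have 3: "(x - 1) * (y - 1) * (\<Sum>i<size P. \<Sum>(a, b)\<in>splits P. g i a b) =
      \<omega> (-2) * (x - 1) * y * ((marked 1 y P Q1 - marked 1 1 P Q1) * y ^ c) +
      \<omega> 1 * (y - 1) * x * ((x * marked x y P Q1 - marked 1 y P Q1) * y ^ c)"
  proof -
    have "(x - 1) * (y - 1) * (\<Sum>i<size P. \<Sum>(a, b)\<in>splits P. g i a b) =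
      (\<Sum>i<size P. \<omega> (-2) * (x - 1) * y * (y ^ (afts P ! i) * q i - q i) * y ^ c
      + \<omega> 1 * (y - 1) * x * (x * (x ^ (befs P ! i) * y ^ (afts P ! i) * q i) - y ^ (afts P ! i) * q i) * y ^ c)"
      by (subst sum_distrib_left) (rule sum.cong[OF refl], rule 2, simp)
    also have "\<dots> = \<omega> (-2) * (x - 1) * y * ((\<Sum>i<size P. y ^ (afts P ! i) * q i) - (\<Sum>i<size P. q i)) * y ^ c
      + \<omega> 1 * (y - 1) * x * (x * (\<Sum>i<size P. x ^ (befs P ! i) * y ^ (afts P ! i) * q i) - (\<Sum>i<size P. y ^ (afts P ! i) * q i)) * y ^ c"
      by (simp only: sum.distrib sum_subtractf sum_distrib_left[symmetric] sum_distrib_right[symmetric])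
    finally show ?thesis by (simp add: marked_def q_def mult.assoc)
  qed
  have 4: "(x - 1) * (y - 1) * ((\<Sum>(a, b)\<in>splits P. x ^ contacts b) * (x * marked x y p Q2)) =
    (y - 1) * x * ((x * x ^ contacts P - 1) * marked x y p Q2)"
    using sum_splits_contacts[of x P] by (metis (no_types, lifting) mult.assoc mult.commute power_Suc)
  show ?thesis
    unfolding 1 distrib_left 3 4 c_def by (simp add: add.assoc)
qed

definition M_ser :: "'a \<Rightarrow> 'a \<Rightarrow> 'a fps" where
  "M_ser x y = Abs_fps (\<lambda>n. \<Sum>(P, Q)\<in>tree_intervals n. marked x y P Q)"

end

section \<open>The series of intervals by contacts, and the two equations\<close>

definition F_ser :: "'a::comm_ring_1 \<Rightarrow> 'a fps" where
  "F_ser x = Abs_fps (\<lambda>n. \<Sum>(P, Q)\<in>tree_intervals n. x ^ contacts P)"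

lemma sum_prod_pairs:
  fixes f g :: "'b \<Rightarrow> 'c \<Rightarrow> 'a::comm_ring_1"
  shows "(\<Sum>(p, q)\<in>A. \<Sum>(r, s)\<in>B. f p q * g r s) = (\<Sum>(p, q)\<in>A. f p q) * (\<Sum>(r, s)\<in>B. g r s)"
  by (simp add: sum_product case_prod_unfold)

lemma fps_X_mult_mult_nth_Suc:
  "fps_nth (fps_X * (fps_const c * (f * g))) (Suc n) = c * (\<Sum>k\<le>n. fps_nth f k * fps_nth g (n - k))"
  for c :: "'a::comm_ring_1"
  by (simp only: fps_X_mult_nth fps_mult_left_const_nth) (simp add: fps_mult_nth atLeast0AtMost)

text \<open>The contacts of \<open>Node a (app b P2)\<close> are one more than those of
  \<open>b\<close> and \<open>P2\<close> together, so the sum over cuts turns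
  \<open>x ^ contacts P1\<close> into a divided difference.\<close>

lemma F_ser_eq:
  "fps_const (x - 1) * (F_ser x - 1) = fps_X * (fps_const x * ((fps_const x * F_ser x - F_ser 1) * F_ser x))"
proof (rule fps_ext)
  fix n
  show "fps_nth (fps_const (x - 1) * (F_ser x - 1)) n =
    fps_nth (fps_X * (fps_const x * ((fps_const x * F_ser x - F_ser 1) * F_ser x))) n"
  proof (cases n)
    case 0
    then show ?thesis by (simp add: F_ser_def)
  next
    case (Suc m)
    have 1: "(x - 1) * (\<Sum>(a, b)\<in>splits P. x ^ contacts (Node a (app b R))) = x * ((x * x ^ contacts P - 1) * x ^ contacts R)"
      for P R
    proof -
      have "(\<Sum>(a, b)\<in>splits P. x ^ contacts (Node a (app b R))) = (\<Sum>(a, b)\<in>splits P. x ^ contacts b) * (x * x ^ contacts R)"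
        unfolding sum_distrib_right by (rule sum.cong) (auto simp: power_add mult_ac)
      then show ?thesis using sum_splits_contacts[of x P] by (simp flip: mult.assoc)
    qed
    let ?S = "\<lambda>g. \<Sum>k\<le>m. \<Sum>(P1, Q1)\<in>tree_intervals k. \<Sum>(P2, Q2)\<in>tree_intervals (m - k). g P1 Q1 P2 Q2"
    have Sl: "?S (\<lambda>P1 Q1 P2 Q2. c * h P1 Q1 P2 Q2) = c * ?S h" for c :: 'a and h
      by (simp add: sum_distrib_left case_prod_unfold)
    have "fps_nth (fps_const (x - 1) * (F_ser x - 1)) n =
      (\<Sum>k\<le>m. \<Sum>(P1, Q1)\<in>tree_intervals k. \<Sum>(P2, Q2)\<in>tree_intervals (m - k).
        (x - 1) * (\<Sum>(a, b)\<in>splits P1. x ^ contacts (Node a (app b P2))))"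
      by (simp only: Sl) (simp add: Suc F_ser_def sum_tree_intervals_Suc)
    also have "\<dots> = (\<Sum>k\<le>m. x * ((\<Sum>(P1, Q1)\<in>tree_intervals k. x * x ^ contacts P1 - 1) * (\<Sum>(P2, Q2)\<in>tree_intervals (m - k). x ^ contacts P2)))"
      unfolding 1 sum_prod_pairs[symmetric] by (simp add: sum_distrib_left case_prod_unfold)
    also have "\<dots> = fps_nth (fps_X * (fps_const x * ((fps_const x * F_ser x - F_ser 1) * F_ser x))) n"
      unfolding Suc fps_X_mult_mult_nth_Suc
      by (simp add: F_ser_def sum_distrib_left case_prod_unfold sum_subtractf)
    finally show ?thesis .
  qed
qed

context height_weight
begin

lemma M_ser_eq:
  "fps_const ((x - 1) * (y - 1)) * M_ser x y = fps_const ((x - 1) * (y - 1)) * (F_ser y - 1) +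
    fps_X * (fps_const (\<omega> (-2) * (x - 1) * y) * ((M_ser 1 y - M_ser 1 1) * F_ser y)) +
    fps_X * (fps_const (\<omega> 1 * (y - 1) * x) * ((fps_const x * M_ser x y - M_ser 1 y) * F_ser y)) +
    fps_X * (fps_const ((y - 1) * x) * ((fps_const x * F_ser x - F_ser 1) * M_ser x y))"
  (is "?L = ?R")
proof (rule fps_ext)
  fix n
  show "fps_nth ?L n = fps_nth ?R n"
  proof (cases n)
    case 0
    then show ?thesis by (simp add: F_ser_def M_ser_def marked_def)
  next
    case (Suc m)
    let ?S = "\<lambda>g. \<Sum>k\<le>m. \<Sum>(P1, Q1)\<in>tree_intervals k. \<Sum>(P2, Q2)\<in>tree_intervals (m - k). g P1 Q1 P2 Q2"
    have S: "?S (\<lambda>P1 Q1 P2 Q2. f P1 Q1 * g P2 Q2) =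
       (\<Sum>k\<le>m. (\<Sum>(P1, Q1)\<in>tree_intervals k. f P1 Q1) * (\<Sum>(P2, Q2)\<in>tree_intervals (m - k). g P2 Q2))" for f g :: "btree \<Rightarrow> btree \<Rightarrow> 'a"
      by (simp add: sum_prod_pairs)
    have Sl: "?S (\<lambda>P1 Q1 P2 Q2. c * h P1 Q1 P2 Q2) = c * ?S h" for c :: 'a and h
      by (simp add: sum_distrib_left case_prod_unfold)
    have Sa: "?S (\<lambda>P1 Q1 P2 Q2. h P1 Q1 P2 Q2 + h' P1 Q1 P2 Q2) = ?S h + ?S h'" for h h' :: "btree \<Rightarrow> btree \<Rightarrow> btree \<Rightarrow> btree \<Rightarrow> 'a"
      by (simp add: sum.distrib case_prod_unfold)
    have F: "?S (\<lambda>P1 Q1 P2 Q2. \<Sum>(a, b)\<in>splits P1. y ^ contacts (Node a (app b P2))) = fps_nth (F_ser y - 1) n"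
      by (simp add: Suc F_ser_def sum_tree_intervals_Suc)
    have "fps_nth ?L n =
      ?S (\<lambda>P1 Q1 P2 Q2. (x - 1) * (y - 1) * (\<Sum>(a, b)\<in>splits P1. marked x y (Node a (app b P2)) (Node Q1 Q2)))"
      by (simp only: Sl) (simp add: Suc M_ser_def sum_tree_intervals_Suc)
    also have "\<dots> = ?S (\<lambda>P1 Q1 P2 Q2. (x - 1) * (y - 1) * (\<Sum>(a, b)\<in>splits P1. y ^ contacts (Node a (app b P2))) +
        \<omega> (-2) * (x - 1) * y * ((marked 1 y P1 Q1 - marked 1 1 P1 Q1) * y ^ contacts P2) +
        \<omega> 1 * (y - 1) * x * ((x * marked x y P1 Q1 - marked 1 y P1 Q1) * y ^ contacts P2) +
        (y - 1) * x * ((x * x ^ contacts P1 - 1) * marked x y P2 Q2))"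
      by (intro sum.cong refl, clarify, intro sum.cong refl, clarify, rule sum_splits_marked_Node)
         (auto simp: tree_intervals_def)
    also have "\<dots> = fps_nth ?R n"
      unfolding Sa Sl S F unfolding Suc fps_add_nth fps_X_mult_mult_nth_Suc
      by (simp add: F_ser_def M_ser_def sum_distrib_left case_prod_unfold sum_subtractf)
    finally show ?thesis .
  qed
qed

end

section \<open>Substitution of power series and the kernel method\<close>

text \<open>Substitution of the outer variable by the inner one.\<close>

definition diag :: "'a::comm_ring_1 fps fps \<Rightarrow> 'a fps" where
  "diag A = Abs_fps (\<lambda>n. \<Sum>k\<le>n. fps_nth (fps_nth A k) (n - k))"

lemma diag_nth: "fps_nth (diag A) n = (\<Sum>k\<le>n. fps_nth (fps_nth A k) (n - k))"
  by (simp add: diag_def)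

lemma diag_add: "diag (A + B) = diag A + diag B"
  by (rule fps_ext) (simp add: diag_nth sum.distrib)

lemma diag_diff: "diag (A - B) = diag A - diag B"
  by (rule fps_ext) (simp add: diag_nth sum_subtractf)

lemma diag_const [simp]: "diag (fps_const c) = c"
proof (rule fps_ext)
  fix n
  have "(\<Sum>k\<le>n. fps_nth (fps_nth (fps_const c) k) (n - k)) = (\<Sum>k\<in>{0}. fps_nth c (n - k))"
    by (rule sum.mono_neutral_cong_right) auto
  then show "fps_nth (diag (fps_const c)) n = fps_nth c n" by (simp add: diag_nth)
qed

lemma diag_one [simp]: "diag 1 = 1"
  using diag_const[of 1] by simp

lemma diag_unfold: "diag A = fps_nth A 0 + fps_X * diag (fps_shift 1 A)"
proof (rule fps_ext)
  fix n
  show "fps_nth (diag A) n = fps_nth (fps_nth A 0 + fps_X * diag (fps_shift 1 A)) n"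
    by (cases n) (simp_all add: diag_nth sum.atMost_Suc_shift del: sum.atMost_Suc)
qed

lemma diag_X_mult [simp]: "diag (fps_X * A) = fps_X * diag A"
proof -
  have "fps_shift 1 (fps_X * A) = A" by (rule fps_ext) simp
  then show ?thesis by (subst diag_unfold) simp
qed

lemma diag_X [simp]: "diag fps_X = fps_X"
  using diag_X_mult[of 1] by simp

text \<open>Splitting off the constant terms of \<open>A\<close> and \<open>B\<close> reduces each
  coefficient to the preceding one of two other products. Thus \<open>diag\<close> is a ring
  homomorphism, and functional equations survive the substitution.\<close>

lemma diag_mult: "diag (A * B) = diag A * diag B"
proof (rule fps_ext)
  fix n
  show "fps_nth (diag (A * B)) n = fps_nth (diag A * diag B) n"
  proof (induction n arbitrary: A B)
    case 0
    then show ?case by (simp add: diag_nth)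
  next
    case (Suc n)
    define A' B' where "A' = fps_shift 1 A" and "B' = fps_shift 1 B"
    have A: "A = fps_const (fps_nth A 0) + fps_X * A'" and B: "B = fps_const (fps_nth B 0) + fps_X * B'"
      unfolding A'_def B'_def by (rule fps_ext; simp add: fps_X_mult_nth)+
    have "A * B = fps_const (fps_nth A 0 * fps_nth B 0) + fps_X * (fps_const (fps_nth A 0) * B' + A' * B)"
      by (subst A, subst B, subst (3) B) (simp add: algebra_simps flip: fps_const_mult)
    then have "diag (A * B) = fps_nth A 0 * fps_nth B 0 + fps_X * (diag (fps_const (fps_nth A 0) * B') + diag (A' * B))"
      by (simp add: diag_add)
    moreover have "diag A = fps_nth A 0 + fps_X * diag A'" unfolding A'_def by (rule diag_unfold)
    moreover have dB: "diag B = fps_nth B 0 + fps_X * diag B'" unfolding B'_def by (rule diag_unfold)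
    then have "(fps_nth A 0 + fps_X * diag A') * diag B =
       fps_nth A 0 * fps_nth B 0 + fps_X * (fps_nth A 0 * diag B' + diag A' * diag B)"
      by (simp add: algebra_simps)
    ultimately show ?case
      using Suc.IH[of "fps_const (fps_nth A 0)" B'] Suc.IH[of A' B] by simp
  qed
qed

section \<open>Order of a series, and coefficients polynomial in a constant\<close>

lemma fps_X_power_dvd_iff: "fps_X ^ n dvd f \<longleftrightarrow> (\<forall>k<n. fps_nth f k = 0)"
  for f :: "'a::comm_ring_1 fps"
proof
  assume "fps_X ^ n dvd f"
  then show "\<forall>k<n. fps_nth f k = 0" by (auto elim!: dvdE simp: fps_X_power_mult_nth)
next
  assume "\<forall>k<n. fps_nth f k = 0"
  then have "f = fps_X ^ n * fps_shift n f" by (intro fps_ext) (auto simp: fps_X_power_mult_nth)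
  then show "fps_X ^ n dvd f" by (metis dvd_triv_left)
qed

definition poly_coeffs :: "('a::comm_ring_1 \<Rightarrow> 'a fps) \<Rightarrow> bool" where
  "poly_coeffs f \<longleftrightarrow> (\<forall>n. \<exists>p. \<forall>c. fps_nth (f c) n = poly p c)"

lemma poly_coeffs_const: "poly_coeffs (\<lambda>c. f)"
  unfolding poly_coeffs_def by (metis mult_zero_right add_0_right poly_pCons poly_0)

lemma poly_coeffs_fps_const: "poly_coeffs (fps_const :: 'a::comm_ring_1 \<Rightarrow> 'a fps)"
  unfolding poly_coeffs_def
proof
  fix n :: nat
  have "\<forall>c::'a. fps_nth (fps_const c) n = poly (if n = 0 then [:0, 1:] else 0) c" by auto
  then show "\<exists>p. \<forall>c::'a. fps_nth (fps_const c) n = poly p c" by blast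
qed

lemma poly_fun_sum:
  assumes "\<And>i. i \<in> A \<Longrightarrow> \<exists>p. \<forall>c. f i c = poly p (c::'a::comm_ring_1)"
  shows "\<exists>p. \<forall>c. (\<Sum>i\<in>A. f i c) = poly p c"
proof -
  obtain p where "\<And>i c. i \<in> A \<Longrightarrow> f i c = poly (p i) c" using assms by metis
  then have "\<forall>c. (\<Sum>i\<in>A. f i c) = poly (\<Sum>i\<in>A. p i) c" by (simp add: poly_sum)
  then show ?thesis by blast
qed

lemma poly_coeffs_add: "poly_coeffs f \<Longrightarrow> poly_coeffs g \<Longrightarrow> poly_coeffs (\<lambda>c. f c + g c)"
  unfolding poly_coeffs_def fps_add_nth by (metis poly_add)

lemma poly_coeffs_diff: "poly_coeffs f \<Longrightarrow> poly_coeffs g \<Longrightarrow> poly_coeffs (\<lambda>c. f c - g c)"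
  unfolding poly_coeffs_def fps_sub_nth by (metis poly_diff)

lemma poly_coeffs_mult: "poly_coeffs f \<Longrightarrow> poly_coeffs g \<Longrightarrow> poly_coeffs (\<lambda>c. f c * g c)"
  unfolding poly_coeffs_def fps_mult_nth by (intro allI poly_fun_sum) (metis poly_mult)

lemma poly_coeffs_power: "poly_coeffs f \<Longrightarrow> poly_coeffs (\<lambda>c. f c ^ n)"
  by (induction n) (auto intro: poly_coeffs_mult poly_coeffs_const)

lemma poly_coeffs_sum: "(\<And>i. i \<in> A \<Longrightarrow> poly_coeffs (f i)) \<Longrightarrow> poly_coeffs (\<lambda>c. \<Sum>i\<in>A. f i c)"
  by (induction A rule: infinite_finite_induct) (auto intro: poly_coeffs_add poly_coeffs_const)

lemmas poly_coeffs_intros =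
  poly_coeffs_add poly_coeffs_diff poly_coeffs_mult poly_coeffs_power poly_coeffs_sum
  poly_coeffs_const poly_coeffs_fps_const

text \<open>With constant term 1 the recursion for the coefficients of the inverse needs no
  division, so they remain polynomial.\<close>

lemma poly_coeffs_inverse:
  fixes f :: "'a::field \<Rightarrow> 'a fps"
  assumes f: "poly_coeffs f" and 1: "\<And>c. fps_nth (f c) 0 = 1"
  shows "poly_coeffs (\<lambda>c. inverse (f c))"
  unfolding poly_coeffs_def
proof
  fix n
  show "\<exists>p. \<forall>c. fps_nth (inverse (f c)) n = poly p c"
  proof (induction n rule: less_induct)
    case (less n)
    show ?case
    proof (cases n)
      case 0
      then have "\<forall>c. fps_nth (inverse (f c)) n = poly 1 c" using 1 by simp
      then show ?thesis by blast
    next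
      case (Suc m)
      have "fps_nth (inverse (f c)) n = (\<Sum>i\<le>m. - fps_nth (f c) (n - i) * fps_nth (inverse (f c)) i)" for c
      proof -
        have "fps_nth (inverse (f c) * f c) n = 0" using 1 Suc by (simp add: inverse_mult_eq_1)
        then show ?thesis
          using 1 by (simp add: fps_mult_nth Suc atLeast0AtMost sum_negf add_eq_0_iff2 add_eq_0_iff mult.commute[of "fps_nth (f c) _"])
      qed
      moreover have "\<exists>p. \<forall>c. (\<Sum>i\<le>m. - fps_nth (f c) (n - i) * fps_nth (inverse (f c)) i) = poly p c"
      proof (rule poly_fun_sum)
        fix i assume "i \<in> {..m}"
        then obtain p q where "\<And>c. fps_nth (inverse (f c)) i = poly p c" "\<And>c. fps_nth (f c) (n - i) = poly q c"
          using less Suc f unfolding poly_coeffs_def by (metis atMost_iff le_imp_less_Suc)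
        then have "\<forall>c. - fps_nth (f c) (n - i) * fps_nth (inverse (f c)) i = poly (- q * p) c" by simp
        then show "\<exists>p. \<forall>c. - fps_nth (f c) (n - i) * fps_nth (inverse (f c)) i = poly p c" by blast
      qed
      ultimately show ?thesis by simp
    qed
  qed
qed

lemma poly_coeffs_diag_F_ser:
  assumes "poly_coeffs f"
  shows "poly_coeffs (\<lambda>c. diag (F_ser (f c)))"
proof -
  have "poly_coeffs (\<lambda>c. \<Sum>(P, Q)\<in>tree_intervals k. f c ^ contacts P)" for k
    unfolding case_prod_unfold by (intro poly_coeffs_intros assms)
  then show ?thesis
    unfolding poly_coeffs_def diag_nth F_ser_def fps_nth_Abs_fps
    by (intro allI poly_fun_sum) auto
qed

text \<open>Here \<open>x\<close> is itself a series in t, so this is F(x(t)) as a series in t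
  alone.\<close>

definition F_at :: "'a::comm_ring_1 fps \<Rightarrow> 'a fps" where
  "F_at x = diag (F_ser x)"

lemma F_at_eq: "(x - 1) * (F_at x - 1) = fps_X * (x * ((x * F_at x - F_at 1) * F_at x))"
  using arg_cong[OF F_ser_eq[of x], of diag] by (simp add: F_at_def diag_mult diag_diff)

lemma F_at_nth_0 [simp]: "fps_nth (F_at x) 0 = 1"
  by (simp add: F_at_def diag_nth F_ser_def)

section \<open>Rational parametrization of the series of intervals\<close>

definition X_par :: "'a::field fps \<Rightarrow> 'a fps \<Rightarrow> 'a fps" where
  "X_par z u = (1 + u) * inverse (1 + z * u) ^ 2"

definition G_par :: "'a::field fps \<Rightarrow> 'a fps \<Rightarrow> 'a fps" where
  "G_par z u = (1 + z * u) * (1 - 2 * z - z ^ 2 * u) * inverse (1 - z) ^ 3"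

lemma X_par_minus_1:
  assumes "fps_nth z 0 = 0"
  shows "X_par z u - 1 = u * (1 - 2 * z - z ^ 2 * u) * inverse (1 + z * u) ^ 2"
proof -
  have "inverse (1 + z * u) * (1 + z * u) = 1" by (rule inverse_mult_eq_1) (simp add: assms)
  then show ?thesis unfolding X_par_def by algebra
qed

text \<open>\<open>G_par\<close> satisfies the equation of \<open>F_at\<close>, with u = 0 in the
  role of x = 1. The factor \<open>r\<close> is common to \<open>G_par z u - 1\<close> and
  \<open>X_par z u * G_par z u - G_par z 0\<close>, so both sides split into the same
  factors.\<close>

lemma G_par_eq:
  fixes z u :: "'a::field fps"
  assumes z0: "fps_nth z 0 = 0" and t: "z * (1 - z) ^ 3 = t"
  shows "(X_par z u - 1) * (G_par z u - 1) = t * (X_par z u * ((X_par z u * G_par z u - G_par z 0) * G_par z u))"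
proof -
  define i where "i = inverse (1 + z * u)"
  define j where "j = inverse (1 - z)"
  have i: "i * (1 + z * u) = 1" unfolding i_def by (rule inverse_mult_eq_1) (simp add: z0)
  have j: "j * (1 - z) = 1" unfolding j_def by (rule inverse_mult_eq_1) (simp add: z0)
  have j3: "j ^ 3 * (1 - z) ^ 3 = 1" using j by (metis power_mult_distrib power_one)
  define p where "p = 1 - 2 * z - z ^ 2 * u"
  define r where "r = 1 - 3 * z + z ^ 2 - z ^ 2 * u"
  have 1: "X_par z u - 1 = u * p * i ^ 2"
    using X_par_minus_1[OF z0] unfolding i_def p_def .
  have 2: "G_par z u - 1 = j ^ 3 * z * (1 + u) * r"
    using j3 unfolding G_par_def j_def[symmetric] r_def by algebra
  have 3: "X_par z u * G_par z u - G_par z 0 = i * j ^ 3 * u * r"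
    using i unfolding X_par_def G_par_def i_def[symmetric] j_def[symmetric] r_def by algebra
  have 4: "X_par z u * G_par z u = (1 + u) * p * i * j ^ 3"
    using i unfolding X_par_def G_par_def i_def[symmetric] j_def[symmetric] p_def by algebra
  have "(X_par z u - 1) * (G_par z u - 1) = (z * (1 - z) ^ 3) * (((1 + u) * p * i * j ^ 3) * (i * j ^ 3 * u * r))"
    unfolding 1 2 using j3 by algebra
  then show ?thesis unfolding t 4[symmetric] 3[symmetric] by (simp add: mult_ac)
qed

lemma F_at_X_par:
  fixes z u :: "'a::field fps"
  assumes inf: "infinite (UNIV :: 'a set)"
    and z0: "fps_nth z 0 = 0" and t: "z * (1 - z) ^ 3 = fps_X"
  shows "F_at (X_par z u) = G_par z u"
proof -
  define D where "D u = F_at (X_par z u) - G_par z u" for u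
  have X0: "X_par z 0 = 1" by (simp add: X_par_def)
  \<comment> \<open>Subtracting the two quadratic equations gives a relation linear in the
    differences. Its right side has a factor \<open>fps_X\<close> and involves \<open>D 0\<close>
    besides \<open>D u\<close>, so the orders of all \<open>D u\<close> have to be bounded
    together.\<close>
  have D_eq: "(X_par z u - 1) * D u = fps_X * (X_par z u * ((X_par z u * (F_at (X_par z u) + G_par z u) - F_at 1) * D u - G_par z u * D 0))" for u
  proof -
    have "(X_par z u - 1) * D u = (X_par z u - 1) * (F_at (X_par z u) - 1) - (X_par z u - 1) * (G_par z u - 1)"
      by (simp add: D_def algebra_simps)
    then show ?thesis
      unfolding F_at_eq G_par_eq[OF z0 t] by (simp add: D_def X0 algebra_simps)
  qed
  have pc: "poly_coeffs (\<lambda>c. D (u + fps_const c))" for u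
  proof -
    have "poly_coeffs (\<lambda>c. inverse (1 + z * (u + fps_const c)))"
      by (rule poly_coeffs_inverse, intro poly_coeffs_intros) (simp add: z0)
    then have "poly_coeffs (\<lambda>c. X_par z (u + fps_const c))" "poly_coeffs (\<lambda>c. G_par z (u + fps_const c))"
      unfolding X_par_def G_par_def by (intro poly_coeffs_intros; assumption)+
    then show ?thesis unfolding D_def F_at_def by (intro poly_coeffs_diff poly_coeffs_diag_F_ser)
  qed
  txt \<open>\<open>X_par z u - 1\<close> is a unit if \<open>u\<close> has a nonzero constant term, and then \<open>D_eq\<close> improves the order
    of \<open>D u\<close>. Every other \<open>u\<close> is reached by a constant shift, on which the coefficients of \<open>D\<close> depend
    polynomially.\<close>
  have "fps_X ^ n dvd D u" for n u
  proof (induction n arbitrary: u)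
    case 0
    show ?case by simp
  next
    case (Suc n)
    have nz: "fps_X ^ Suc n dvd D v" if "fps_nth v 0 \<noteq> 0" for v
    proof -
      have "fps_X ^ Suc n dvd (X_par z v - 1) * D v"
        unfolding D_eq power_Suc using Suc.IH by (intro mult_dvd_mono dvd_refl dvd_mult dvd_diff) auto
      moreover have "(X_par z v - 1) dvd 1"
        using that by (simp add: X_par_minus_1[OF z0] z0 power2_eq_square)
      ultimately show ?thesis by (metis dvd_mult_unit_iff' mult.commute)
    qed
    obtain p where p: "\<And>c. fps_nth (D (u + fps_const c)) n = poly p c"
      using pc[of u] unfolding poly_coeffs_def by metis
    have "poly p c = 0" if "c \<noteq> - fps_nth u 0" for c
    proof -
      have "fps_nth (u + fps_const c) 0 \<noteq> 0" using that by (simp add: add_eq_0_iff)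
      from nz[OF this] show ?thesis unfolding fps_X_power_dvd_iff p[symmetric] by simp
    qed
    then have "UNIV - {- fps_nth u 0} \<subseteq> {c. poly p c = 0}" by auto
    then have "infinite {c. poly p c = 0}" using inf finite_subset by fastforce
    then have "p = 0" using poly_roots_finite by blast
    then have "fps_nth (D u) n = 0" using p[of 0] by simp
    then show ?case using Suc.IH[of u] unfolding fps_X_power_dvd_iff by (auto simp: less_Suc_eq)
  qed
  then have "D u = 0" unfolding fps_X_power_dvd_iff by (intro fps_ext) (metis lessI fps_zero_nth)
  then show ?thesis by (simp add: D_def)
qed

text \<open>By the equation for \<open>F_at x\<close>, the coefficient of \<open>M(x, y)\<close>
  times \<open>F_at x\<close> is a multiple of the difference of the two sides of \<open>k1\<close>;
  the coefficient of \<open>M(1, y)\<close> vanishes by \<open>k2\<close> after division by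
  \<open>\<omega> 2\<close>. What is left has the factor \<open>x - 1\<close>, which can be
  cancelled.\<close>

lemma kernel_method:
  fixes \<omega> :: "int \<Rightarrow> 'a::field fps"
  assumes "height_weight \<omega>"
    and k1: "x - 1 = \<omega> 1 * fps_X * x ^ 2 * F_at x * F_at y"
    and k2: "\<omega> 3 * x * (y - 1) = y * (x - 1)"
    and x: "x \<noteq> 1"
  shows "\<omega> 2 * ((y - 1) * (F_at y - 1)) = fps_X * y * F_at y * diag (height_weight.M_ser \<omega> 1 1)"
proof -
  interpret height_weight \<omega> by fact
  define Mxy where "Mxy = diag (M_ser x y)"
  define M1y where "M1y = diag (M_ser 1 y)"
  define M11 where "M11 = diag (M_ser 1 1)"
  define w where "w = \<omega> 1"
  define v where "v = \<omega> (-2)"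
  have w2: "\<omega> 2 = w ^ 2" using weight_add[of 1 1] by (simp add: w_def power2_eq_square)
  have w3: "\<omega> 3 = w ^ 3" using weight_add[of 1 2] w2 by (simp add: w_def power2_eq_square power3_eq_cube)
  have vw: "v * w ^ 2 = 1" using weight_add[of "-2" 2] w2 by (simp add: v_def)
  have Meq: "(x - 1) * (y - 1) * Mxy = (x - 1) * (y - 1) * (F_at y - 1) +
      fps_X * (v * (x - 1) * y * ((M1y - M11) * F_at y)) +
      fps_X * (w * (y - 1) * x * ((x * Mxy - M1y) * F_at y)) +
      fps_X * ((y - 1) * x * ((x * F_at x - F_at 1) * Mxy))"
    using arg_cong[OF M_ser_eq[of x y], of diag]
    by (simp add: diag_add diag_diff diag_mult Mxy_def M1y_def M11_def v_def w_def F_at_def del: fps_const_mult fps_const_sub)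
  have "F_at x \<noteq> 0" using F_at_nth_0[of x] by (metis fps_zero_nth zero_neq_one)
  moreover have "F_at x * ((x - 1) - fps_X * w * x ^ 2 * F_at y - fps_X * x * (x * F_at x - F_at 1)) = 0"
    using F_at_eq[of x] k1[folded w_def] by algebra
  ultimately have c1: "(x - 1) - fps_X * w * x ^ 2 * F_at y - fps_X * x * (x * F_at x - F_at 1) = 0" by simp
  have c2: "w * x * (y - 1) = v * y * (x - 1)" using k2[unfolded w3] vw by algebra
  have "(x - 1) * ((y - 1) * (F_at y - 1) - fps_X * v * y * F_at y * M11) = 0"
    using Meq c1 c2 by algebra
  then have "(y - 1) * (F_at y - 1) = fps_X * v * y * F_at y * M11" using x by simp
  then show ?thesis unfolding w2 M11_def[symmetric] using vw by algebra
qed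

section \<open>Elimination of U\<close>

text \<open>The \<open>a\<close> and \<open>b\<close> are the coefficients of the two equations in
  \<open>S_pol_kernel_solution\<close>, read as quadratics in U; the left side is their Sylvester
  resultant.\<close>

lemma resultant_S_pol:
  fixes V z w :: "'a::idom"
  defines "c \<equiv> (1 - z)^3" and "p \<equiv> 1 - 2*z - z^2*V"
  defines "a2 \<equiv> z*c - w*z*(1+z*V)*p" and "a1 \<equiv> c - 2*w*z*(1+z*V)*p" and "a0 \<equiv> - w*z*(1+z*V)*p"
  defines "b2 \<equiv> z^2*(1+V)" and "b1 \<equiv> w^3*V*p - (1+V)*(1-2*z)" and "b0 \<equiv> w^3*V*p"
  shows "(a2*b0 - a0*b2)^2 + (a1*b0 - a0*b1) * (a1*b2 - a2*b1) = z * w * (w - 1) * (1 - z)^4 * p * S_pol V z w"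
  unfolding assms S_pol_def
  by algebra

text \<open>\<open>V0\<close> is a series in z, whereas intervals are counted by t. Substituting
  z(t) transfers the equation that defines \<open>V0\<close>.\<close>

lemma S_pol_compose:
  fixes V z :: "'a::field fps"
  assumes "fps_nth z 0 = 0"
  shows "S_pol V fps_X (fps_const w) oo z = S_pol (V oo z) z (fps_const w)"
proof -
  have num: "numeral k oo z = numeral k" for k
    by (metis fps_const_compose numeral_fps_const)
  show ?thesis
    unfolding S_pol_def
    by (simp add: fps_compose_add_distrib fps_compose_sub_distrib fps_compose_mult_distrib[OF assms]
      fps_compose_power[OF assms, symmetric] num fps_const_compose fps_X_fps_compose_startby0[OF assms])
qed

text \<open>When the resultant vanishes, the common root of the two quadratics is found by
  eliminating U^2: it is \<open>(a2 * b0 - a0 * b2) / (a1 * b2 - a2 * b1)\<close>.\<close>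

lemma S_pol_kernel_solution:
  fixes z V :: "'a::field fps"
  assumes z0: "fps_nth z 0 = 0" and V0: "fps_nth V 0 = 0" and z: "z \<noteq> 0" and w1: "c \<noteq> 1"
    and S: "S_pol V z w = 0" and w: "w = fps_const c"
  obtains U where "U * (1 + z * U) * (1 - z) ^ 3 = w * z * (1 + U) ^ 2 * (1 + z * V) * (1 - 2 * z - z ^ 2 * V)"
    and "w ^ 3 * (1 + U) * V * (1 - 2 * z - z ^ 2 * V) = (1 + V) * U * (1 - 2 * z - z ^ 2 * U)"
proof -
  define p where "p = 1 - 2 * z - z ^ 2 * V"
  define d where "d = (1 - z) ^ 3"
  define g where "g = w * z * (1 + z * V) * p"
  define a2 where "a2 = z * d - g"
  define a1 where "a1 = d - 2 * g"
  define a0 where "a0 = - g"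
  define b2 where "b2 = z ^ 2 * (1 + V)"
  define b1 where "b1 = w ^ 3 * V * p - (1 + V) * (1 - 2 * z)"
  define b0 where "b0 = w ^ 3 * V * p"
  \<comment> \<open>Numerator and denominator of the common root are both divisible by
    \<open>z\<close>; \<open>N\<close> and \<open>D\<close> are the quotients. The constant term of
    \<open>D\<close> is 1 - c, so \<open>D\<close> is invertible.\<close>
  define N where "N = (d - w * (1 + z * V) * p) * b0 + g * (z * (1 + V))"
  define D where "D = a1 * (z * (1 + V)) - (d - w * (1 + z * V) * p) * b1"
  have N: "z * N = a2 * b0 - a0 * b2" and D: "z * D = a1 * b2 - a2 * b1"
    unfolding N_def D_def a2_def a0_def b2_def g_def by algebra+
  have res: "(a2*b0 - a0*b2)^2 + (a1*b0 - a0*b1) * (a1*b2 - a2*b1) = 0"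
    using resultant_S_pol[of z w V] unfolding S a2_def a1_def a0_def b2_def b1_def b0_def g_def d_def p_def
    by (simp add: mult.assoc)
  have "fps_nth D 0 = 1 - c"
    by (simp add: D_def a1_def b1_def d_def g_def p_def w z0 V0 power2_eq_square power3_eq_cube)
  then have D0: "fps_nth D 0 \<noteq> 0" using w1 by simp
  define U where "U = N * inverse D"
  have UD: "U * D = N" unfolding U_def using inverse_mult_eq_1[OF D0] by (simp add: mult.assoc)
  have "z ^ 2 * (a2 * N ^ 2 + a1 * N * D + a0 * D ^ 2) = 0"
    using N D res by algebra
  then have "a2 * N ^ 2 + a1 * N * D + a0 * D ^ 2 = 0" using z by simp
  then have "D ^ 2 * (a2 * U ^ 2 + a1 * U + a0) = 0" unfolding UD[symmetric] by algebra
  then have E1: "a2 * U ^ 2 + a1 * U + a0 = 0" using D0 by auto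
  have "z ^ 2 * (b2 * N ^ 2 + b1 * N * D + b0 * D ^ 2) = 0"
    using N D res by algebra
  then have "b2 * N ^ 2 + b1 * N * D + b0 * D ^ 2 = 0" using z by simp
  then have "D ^ 2 * (b2 * U ^ 2 + b1 * U + b0) = 0" unfolding UD[symmetric] by algebra
  then have E2: "b2 * U ^ 2 + b1 * U + b0 = 0" using D0 by auto
  show thesis
  proof
    show "U * (1 + z * U) * (1 - z) ^ 3 = w * z * (1 + U) ^ 2 * (1 + z * V) * (1 - 2 * z - z ^ 2 * V)"
      using E1 unfolding a2_def a1_def a0_def g_def d_def p_def by algebra
    show "w ^ 3 * (1 + U) * V * (1 - 2 * z - z ^ 2 * V) = (1 + V) * U * (1 - 2 * z - z ^ 2 * U)"
      using E2 unfolding b2_def b1_def b0_def p_def by algebra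
  qed
qed

text \<open>For \<open>X = X_par z U\<close> and \<open>Y = X_par z V\<close> the two conditions of
  \<open>kernel_method\<close> are \<open>E1\<close> and \<open>E2\<close> up to unit
  factors.\<close>

lemma diag_M_ser_eq_R_fun:
  fixes z V :: "'a::field fps" and \<omega> :: "int \<Rightarrow> 'a fps"
  assumes inf: "infinite (UNIV :: 'a set)" and hw: "height_weight \<omega>"
    and z0: "fps_nth z 0 = 0" and t: "z * (1 - z) ^ 3 = fps_X"
    and V0: "fps_nth V 0 = 0" and S: "S_pol V z w = 0"
    and w: "w = fps_const c" "\<omega> 1 = w" and c: "c \<noteq> 0" "c \<noteq> 1"
  shows "diag (height_weight.M_ser \<omega> 1 1) = R_fun z V w"
proof -
  have z: "z \<noteq> 0" using t by auto
  obtain U where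
    E1: "U * (1 + z * U) * (1 - z) ^ 3 = w * z * (1 + U) ^ 2 * (1 + z * V) * (1 - 2 * z - z ^ 2 * V)"
    and E2: "w ^ 3 * (1 + U) * V * (1 - 2 * z - z ^ 2 * V) = (1 + V) * U * (1 - 2 * z - z ^ 2 * U)"
    by (rule S_pol_kernel_solution[OF z0 V0 z c(2) S w(1)])
  have w2: "\<omega> 2 = w ^ 2"
    using height_weight.weight_add[OF hw, of 1 1] w(2) by (simp add: power2_eq_square)
  have w3: "\<omega> 3 = w ^ 3"
    using height_weight.weight_add[OF hw, of 1 2] w2 w(2) by (simp add: power2_eq_square power3_eq_cube)
  define M where "M = diag (height_weight.M_ser \<omega> 1 1)"
  define X where "X = X_par z U"
  define Y where "Y = X_par z V"
  define i where "i = inverse (1 + z * U)"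
  define k where "k = inverse (1 + z * V)"
  define j where "j = inverse (1 - z)"
  have i: "i * (1 + z * U) = 1" unfolding i_def by (rule inverse_mult_eq_1) (simp add: z0)
  have k: "k * (1 + z * V) = 1" unfolding k_def by (rule inverse_mult_eq_1) (simp add: z0)
  have j: "j * (1 - z) = 1" unfolding j_def by (rule inverse_mult_eq_1) (simp add: z0)
  have j3: "j ^ 3 * (1 - z) ^ 3 = 1" using j by (metis power_mult_distrib power_one)
  define p where "p = 1 - 2 * z - z ^ 2 * U"
  define q where "q = 1 - 2 * z - z ^ 2 * V"
  have p0: "fps_nth p 0 = 1" and q0: "fps_nth q 0 = 1"
    by (simp_all add: p_def q_def z0 power2_eq_square)
  have X1: "X - 1 = U * p * i ^ 2" and Y1: "Y - 1 = V * q * k ^ 2"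
    unfolding X_def Y_def i_def k_def p_def q_def by (rule X_par_minus_1[OF z0])+
  have X: "X = (1 + U) * i ^ 2" and Y: "Y = (1 + V) * k ^ 2"
    unfolding X_def Y_def i_def k_def X_par_def by simp_all
  have FX: "F_at X = (1 + z * U) * p * j ^ 3" and FY: "F_at Y = (1 + z * V) * q * j ^ 3"
    unfolding X_def Y_def F_at_X_par[OF inf z0 t] G_par_def p_def q_def j_def by simp_all
  have k1: "X - 1 = \<omega> 1 * fps_X * X ^ 2 * F_at X * F_at Y"
  proof -
    have "\<omega> 1 * fps_X * X ^ 2 * F_at X * F_at Y =
        (w * z * (1 + U) ^ 2 * (1 + z * V) * q) * ((1 - z) ^ 3 * j ^ 3) * j ^ 3 * p * i ^ 3 * (i * (1 + z * U))"
      unfolding FX FY unfolding X w(2) t[symmetric] by algebra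
    also have "\<dots> = U * p * i ^ 2 * (i * (1 + z * U)) * ((1 - z) ^ 3 * j ^ 3)"
      unfolding E1[folded q_def, symmetric] using i j3 by algebra
    finally show ?thesis using i j3 X1 by (simp add: mult.commute)
  qed
  have k2: "\<omega> 3 * X * (Y - 1) = Y * (X - 1)"
    unfolding w3 X1 Y1 unfolding X Y using E2[folded p_def q_def] by algebra
  \<comment> \<open>\<open>X = 1\<close> would force \<open>U = 0\<close>, and then
    \<open>E1\<close> would make the nonzero product \<open>w * z * (1 + z * V) * q\<close>
    vanish.\<close>
  have "X \<noteq> 1"
  proof
    assume "X = 1"
    then have "U * (p * i ^ 2) = 0" using X1 by (simp add: mult.assoc)
    moreover have "i \<noteq> 0" using i by auto
    moreover have "p \<noteq> 0" using p0 by auto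
    ultimately have "U = 0" by simp
    then have "w * z * (1 + z * V) * q = 0" using E1 q_def by simp
    moreover have "1 + z * V \<noteq> 0" using k by auto
    moreover have "q \<noteq> 0" using q0 by auto
    ultimately show False using w c z by simp
  qed
  from kernel_method[OF hw k1 k2 this]
  have M: "w ^ 2 * ((Y - 1) * (F_at Y - 1)) = z * (1 - z) ^ 3 * Y * F_at Y * M"
    unfolding w2 M_def t .
  define r where "r = 1 - 3 * z + z ^ 2 - z ^ 2 * V"
  have FY1: "(F_at Y - 1) = j ^ 3 * (z * (1 + V) * r)"
    using j3 unfolding FY q_def r_def by algebra
  have "(z * (1 + V) * q * k ^ 2 * j ^ 3) * ((1 + z * V) * (1 - z) ^ 3 * M) = (z * (1 + V) * q * k ^ 2 * j ^ 3) * (w ^ 2 * V * r)"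
    using M unfolding Y1 FY1 unfolding FY unfolding Y by algebra
  moreover have "z * (1 + V) * q * k ^ 2 * j ^ 3 \<noteq> 0"
  proof -
    have "fps_nth (1 + V) 0 \<noteq> 0" by (simp add: V0)
    then have "1 + V \<noteq> 0" by (metis fps_zero_nth)
    moreover have "q \<noteq> 0" using q0 by auto
    moreover have "k \<noteq> 0" "j \<noteq> 0" using k j by auto
    ultimately show ?thesis using z by simp
  qed
  ultimately have M': "(1 + z * V) * (1 - z) ^ 3 * M = w ^ 2 * V * r" by simp
  \<comment> \<open>\<open>num\<close> is \<open>- (w ^ 2 * V * r)\<close> and \<open>den\<close> is
    \<open>- ((1 + z * V) * (1 - z) ^ 3)\<close>.\<close>
  define num where "num = (V*z^2 - z^2 + 3*z - 1) * V * w^2"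
  define den where "den = V*z^4 - 3*V*z^3 + 3*V*z^2 + z^3 - V*z - 3*z^2 + 3*z - 1"
  have "den * M = num"
    using M' unfolding den_def num_def r_def by algebra
  moreover have "fps_nth den 0 \<noteq> 0"
    by (simp add: den_def z0 power2_eq_square power3_eq_cube power4_eq_xxxx)
  then have "inverse den * den = 1" by (rule inverse_mult_eq_1)
  ultimately have "M = num * inverse den" by (metis mult.assoc mult.commute mult_1)
  then show ?thesis unfolding M_def R_fun_def num_def den_def .
qed

section \<open>Algebraicity\<close>

text \<open>Stated for an indexed family because two of the products to which it is applied may
  coincide as series; an equal pair is already dependent.\<close>

lemma (in vector_space) family_dependent:
  assumes B: "finite B" and I: "finite I" and e: "\<And>i. i \<in> I \<Longrightarrow> e i \<in> span B" and card: "card B < card I"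
  shows "\<exists>c. (\<exists>i\<in>I. c i \<noteq> 0) \<and> (\<Sum>i\<in>I. scale (c i) (e i)) = 0"
proof (cases "inj_on e I")
  case True
  have "dependent (e ` I)"
  proof (rule ccontr)
    assume "\<not> dependent (e ` I)"
    then have "card (e ` I) \<le> card B" using independent_span_bound[OF B] e by blast
    then show False using card True by (simp add: card_image)
  qed
  then obtain u v where u: "v \<in> e ` I" "u v \<noteq> 0" "(\<Sum>v\<in>e ` I. scale (u v) v) = 0"
    using dependent_finite[of "e ` I"] I by auto
  then have "(\<Sum>i\<in>I. scale (u (e i)) (e i)) = 0"
    using sum.reindex[OF True, of "\<lambda>v. scale (u v) v"] by simp
  then show ?thesis by (intro exI[of _ "\<lambda>i. u (e i)"]) (use u in auto)
next
  case False
  then obtain i j where ij: "i \<in> I" "j \<in> I" "i \<noteq> j" "e i = e j" by (auto simp: inj_on_def)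
  define c where "c k = (if k = i then 1 else if k = j then - 1 else 0 :: 'a)" for k
  have "(\<Sum>k\<in>I. scale (c k) (e k)) = (\<Sum>k\<in>{i, j}. scale (c k) (e k))"
    by (rule sum.mono_neutral_cong_right) (use I ij in \<open>auto simp: c_def\<close>)
  also have "\<dots> = 0" using ij by (simp add: c_def)
  finally have "(\<Sum>k\<in>I. scale (c k) (e k)) = 0" .
  moreover have "c i \<noteq> 0" by (simp add: c_def)
  ultimately show ?thesis using ij by blast
qed

interpretation fps_vs: vector_space "\<lambda>c f. fps_const c * f :: 'a::field fps"
  by unfold_locales (simp_all add: distrib_left distrib_right mult.assoc flip: fps_const_add fps_const_mult)

text \<open>If every power of \<open>y\<close> reduces to lower ones, multiplication by a fixed polynomial in \<open>z\<close> and
  \<open>y\<close> raises the degree in \<open>z\<close> only by a constant. So the monomials \<open>t ^ a * N ^ b * D ^ (L - b)\<close>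
  in polynomials \<open>t\<close>, \<open>N\<close>, \<open>D\<close>, quadratically many in \<open>L\<close>, live in a space of dimension linear in \<open>L\<close>.\<close>

locale reduced_span =
  fixes z y :: "'a::field fps" and d :: nat
begin

definition mons :: "nat \<Rightarrow> 'a fps set" where
  "mons m = (\<lambda>(i, j). z ^ i * y ^ j) ` ({..m} \<times> {..<d})"

definition gap :: "nat \<Rightarrow> 'a fps set" where
  "gap m = fps_vs.span (mons m)"

lemma finite_mons: "finite (mons m)"
  by (simp add: mons_def)

lemma card_mons: "card (mons m) \<le> Suc m * d"
  unfolding mons_def by (rule order_trans[OF card_image_le]) (simp_all add: card_cartesian_product)

lemma gap_mono: "m \<le> n \<Longrightarrow> gap m \<subseteq> gap n"
  unfolding gap_def by (rule fps_vs.span_mono) (auto simp: mons_def)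

lemma mon_in_gap: "i \<le> m \<Longrightarrow> j < d \<Longrightarrow> z ^ i * y ^ j \<in> gap m"
  unfolding gap_def by (rule fps_vs.span_base) (auto simp: mons_def)

lemma gap_mult:
  assumes "\<And>i j. i \<le> m \<Longrightarrow> j < d \<Longrightarrow> g * (z ^ i * y ^ j) \<in> gap n" and "f \<in> gap m"
  shows "g * f \<in> gap n"
  using assms(2) unfolding gap_def
proof (induction rule: fps_vs.span_induct_alt)
  case base
  show ?case by (simp add: fps_vs.span_zero)
next
  case (step c x f)
  then have "g * x \<in> fps_vs.span (mons n)" using assms(1) by (auto simp: mons_def gap_def)
  then have "fps_const c * (g * x) + g * f \<in> fps_vs.span (mons n)"
    using step by (intro fps_vs.span_add fps_vs.span_scale)
  then show ?case by (simp add: algebra_simps)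
qed

definition growth :: "'a fps \<Rightarrow> bool" where
  "growth g \<longleftrightarrow> (\<exists>C. \<forall>m. \<forall>f\<in>gap m. g * f \<in> gap (m + C))"

lemma growth_z: "growth z"
  unfolding growth_def
proof (rule exI[of _ 1], intro allI ballI, rule gap_mult[rotated], assumption)
  fix m i j :: nat assume "i \<le> m" "j < d"
  then have "z ^ Suc i * y ^ j \<in> gap (m + 1)" by (intro mon_in_gap) auto
  then show "z * (z ^ i * y ^ j) \<in> gap (m + 1)" unfolding power_Suc mult.assoc .
qed

lemma growth_const: "growth (fps_const c)"
  unfolding growth_def gap_def by (intro exI[of _ 0] allI ballI) (auto intro: fps_vs.span_scale)

lemma growth_add:
  assumes "growth g" "growth h"
  shows "growth (g + h)"
proof -
  obtain C C' where C: "\<And>m f. f \<in> gap m \<Longrightarrow> g * f \<in> gap (m + C)" "\<And>m f. f \<in> gap m \<Longrightarrow> h * f \<in> gap (m + C')"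
    using assms unfolding growth_def by metis
  have "(g + h) * f \<in> gap (m + (C + C'))" if "f \<in> gap m" for m f
  proof -
    have "g * f \<in> gap (m + (C + C'))" "h * f \<in> gap (m + (C + C'))"
      using C[OF that] gap_mono[of "m + C" "m + (C + C')"] gap_mono[of "m + C'" "m + (C + C')"] by auto
    then show ?thesis unfolding gap_def distrib_right by (rule fps_vs.span_add)
  qed
  then show ?thesis unfolding growth_def by blast
qed

lemma growth_mult:
  assumes "growth g" "growth h"
  shows "growth (g * h)"
proof -
  obtain C C' where C: "\<And>m f. f \<in> gap m \<Longrightarrow> g * f \<in> gap (m + C)" "\<And>m f. f \<in> gap m \<Longrightarrow> h * f \<in> gap (m + C')"
    using assms unfolding growth_def by metis
  have "g * h * f \<in> gap (m + (C' + C))" if "f \<in> gap m" for m f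
    using C(1)[OF C(2)[OF that]] by (simp add: mult.assoc add.assoc)
  then show ?thesis unfolding growth_def by blast
qed

lemma growth_minus: "growth g \<Longrightarrow> growth (- g)"
  using growth_mult[OF growth_const[of "- 1"], of g] by simp

lemma growth_diff: "growth g \<Longrightarrow> growth h \<Longrightarrow> growth (g - h)"
  using growth_add[OF _ growth_minus, of g h] by simp

lemma growth_1: "growth 1"
  using growth_const[of 1] by simp

lemma growth_numeral: "growth (numeral n)"
  using growth_const[of "numeral n"] by (simp add: numeral_fps_const)

lemma growth_power: "growth g \<Longrightarrow> growth (g ^ n)"
  by (induction n) (auto intro: growth_1 growth_mult)

lemmas growth_intros = growth_z growth_const growth_add growth_minus growth_diff growth_mult growth_power
  growth_1 growth_numeral

definition reduced :: "'a fps \<Rightarrow> bool" where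
  "reduced f \<longleftrightarrow> (\<exists>m. f \<in> gap m)"

lemma reduced_mult: "growth g \<Longrightarrow> reduced f \<Longrightarrow> reduced (g * f)"
  unfolding growth_def reduced_def by blast

lemma reduced_add: "reduced f \<Longrightarrow> reduced g \<Longrightarrow> reduced (f + g)"
proof -
  assume "reduced f" "reduced g"
  then obtain m n where "f \<in> gap m" "g \<in> gap n" by (auto simp: reduced_def)
  then have "f \<in> gap (m + n)" "g \<in> gap (m + n)"
    using gap_mono[of m "m + n"] gap_mono[of n "m + n"] by auto
  then have "f + g \<in> gap (m + n)" unfolding gap_def by (rule fps_vs.span_add)
  then show "reduced (f + g)" unfolding reduced_def by blast
qed

lemma reduced_power: "j < d \<Longrightarrow> reduced (y ^ j)"
  unfolding reduced_def using mon_in_gap[of 0 0 j] by auto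

text \<open>Only the monomials \<open>z ^ i * y ^ (d - 1)\<close> leave the spanning set, becoming
  \<open>z ^ i * y ^ d\<close>; multiplying the reduction of \<open>y ^ d\<close> by
  \<open>z ^ i\<close> raises its degree in \<open>z\<close> by \<open>i\<close>.\<close>

lemma growth_y:
  assumes "reduced (y ^ d)"
  shows "growth y"
proof -
  obtain e where e: "y ^ d \<in> gap e" using assms by (auto simp: reduced_def)
  show ?thesis
    unfolding growth_def
  proof (rule exI[of _ e], intro allI ballI, rule gap_mult[rotated], assumption)
    fix m i j :: nat assume i: "i \<le> m" and j: "j < d"
    show "y * (z ^ i * y ^ j) \<in> gap (m + e)"
    proof (cases "Suc j < d")
      case True
      then show ?thesis using mon_in_gap[of i "m + e" "Suc j"] i by (simp add: mult_ac)
    next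
      case False
      then have "Suc j = d" using j by simp
      moreover have "z ^ k * y ^ d \<in> gap (e + k)" for k
      proof (induction k)
        case 0
        show ?case using e by simp
      next
        case (Suc k)
        have "z * f \<in> gap (Suc m)" if "f \<in> gap m" for m f
          using that
        proof (rule gap_mult[rotated])
          fix i j assume "i \<le> m" "j < d"
          then have "z ^ Suc i * y ^ j \<in> gap (Suc m)" by (intro mon_in_gap) auto
          then show "z * (z ^ i * y ^ j) \<in> gap (Suc m)" unfolding power_Suc mult.assoc .
        qed
        from this[OF Suc] show ?case by (simp add: mult.assoc)
      qed
      from this[of i] have "z ^ i * y ^ d \<in> gap (m + e)" using gap_mono[of "e + i" "m + e"] i by auto
      ultimately show ?thesis by (metis mult.left_commute power_Suc)
    qed
  qed
qed

text \<open>Since \<open>M * D = N\<close>, a linear dependence among the products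
  \<open>fps_X ^ a * N ^ b * D ^ (L - b)\<close> is \<open>D ^ L\<close> times a polynomial relation
  for \<open>M\<close>.\<close>

lemma algebraic_quotient:
  assumes d: "0 < d" and t: "growth fps_X" and N: "growth N" and D: "growth D" "D \<noteq> 0" and M: "M * D = N"
  shows "\<exists>p :: 'a fps poly. p \<noteq> 0 \<and> (\<forall>i. \<exists>q. coeff p i = fps_of_poly q) \<and> poly p M = 0"
proof -
  obtain C1 where C1: "\<And>m f. f \<in> gap m \<Longrightarrow> fps_X * f \<in> gap (m + C1)" using t unfolding growth_def by metis
  obtain C2 where C2: "\<And>m f. f \<in> gap m \<Longrightarrow> N * f \<in> gap (m + C2)" using N unfolding growth_def by metis
  obtain C3 where C3: "\<And>m f. f \<in> gap m \<Longrightarrow> D * f \<in> gap (m + C3)" using D unfolding growth_def by metis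
  define C where "C = C1 + C2 + C3"
  have C: "fps_X * f \<in> gap (m + C)" "N * f \<in> gap (m + C)" "D * f \<in> gap (m + C)" if "f \<in> gap m" for m f
    using C1[OF that] C2[OF that] C3[OF that] gap_mono[of "m + C1" "m + C"] gap_mono[of "m + C2" "m + C"]
      gap_mono[of "m + C3" "m + C"] by (auto simp: C_def)
  have pow: "g ^ k * f \<in> gap (m + k * C)" if "\<And>m f. f \<in> gap m \<Longrightarrow> g * f \<in> gap (m + C)" "f \<in> gap m" for g k f m
    using that(2)
  proof (induction k arbitrary: f m)
    case 0
    then show ?case by simp
  next
    case (Suc k)
    from Suc.IH[OF that(1)[OF Suc.prems]] show ?case by (simp add: mult_ac add_ac)
  qed
  \<comment> \<open>Each product has \<open>a + L\<close>, hence at most \<open>2 * L\<close>,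
    factors, and each factor raises the degree by at most \<open>C\<close>. This \<open>L\<close>
    makes the \<open>Suc L * Suc L\<close> products outnumber the at most
    \<open>Suc (2 * L * C) * d\<close> spanning monomials.\<close>
  define L where "L = 2 * d * C + d"
  define I where "I = {..L} \<times> {..L}"
  define e where "e = (\<lambda>(a, b). fps_X ^ a * (N ^ b * (D ^ (L - b) * 1)))"
  have "e i \<in> gap (2 * L * C)" if iI: "i \<in> I" for i
  proof -
    obtain a b where i: "i = (a, b)" "a \<le> L" "b \<le> L" using iI by (cases i) (auto simp: I_def)
    have "1 \<in> gap 0" using mon_in_gap[of 0 0 0] d by simp
    from pow[OF C(1) pow[OF C(2) pow[OF C(3) this]], of a b "L - b"]
    have "e i \<in> gap (0 + (L - b) * C + b * C + a * C)" by (simp add: e_def i)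
    also have "0 + (L - b) * C + b * C + a * C = (L + a) * C" using i by (simp flip: add_mult_distrib)
    finally show ?thesis using gap_mono[of "(L + a) * C" "2 * L * C"] i by auto
  qed
  moreover have "card (mons (2 * L * C)) < card I"
  proof -
    have "card (mons (2 * L * C)) \<le> Suc (2 * L * C) * d" by (rule card_mons)
    also have "\<dots> = L * (2 * d * C) + d" by (simp add: algebra_simps)
    also have "\<dots> < Suc L * Suc L" by (simp add: L_def algebra_simps)
    also have "\<dots> = card I" by (simp add: I_def card_cartesian_product)
    finally show ?thesis .
  qed
  ultimately obtain c where c: "\<exists>i\<in>I. c i \<noteq> 0" "(\<Sum>i\<in>I. fps_const (c i) * e i) = 0"
    using fps_vs.family_dependent[OF finite_mons, of I e "2 * L * C"] by (auto simp: gap_def I_def)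
  define q where "q b = (\<Sum>a\<le>L. monom (c (a, b)) a)" for b
  define p where "p = (\<Sum>b\<le>L. monom (fps_of_poly (q b)) b)"
  have cp: "coeff p b = (if b \<le> L then fps_of_poly (q b) else 0)" for b
    by (simp add: p_def coeff_sum)
  have cq: "coeff (q b) a = (if a \<le> L then c (a, b) else 0)" for a b
    by (simp add: q_def coeff_sum)
  have "p \<noteq> 0"
  proof
    assume "p = 0"
    then have "q b = 0" if "b \<le> L" for b using cp[of b] that by simp
    then have "c (a, b) = 0" if "a \<le> L" "b \<le> L" for a b using cq[of b a] that by simp
    then show False using c(1) by (auto simp: I_def)
  qed
  moreover have "\<exists>q. coeff p i = fps_of_poly q" for i
    unfolding cp by (metis fps_of_poly_0)
  moreover have "poly p M = 0"
  proof -
    have "poly p M * D ^ L = (\<Sum>b\<le>L. \<Sum>a\<le>L. fps_const (c (a, b)) * e (a, b))"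
      unfolding p_def poly_sum sum_distrib_right
    proof (rule sum.cong[OF refl])
      fix b assume "b \<in> {..L}"
      then have "M ^ b * D ^ L = M ^ b * (D ^ b * D ^ (L - b))" by (simp flip: power_add)
      then have MD: "M ^ b * D ^ L = N ^ b * D ^ (L - b)"
        by (simp add: power_mult_distrib flip: M mult.assoc)
      have "poly (monom (fps_of_poly (q b)) b) M * D ^ L = fps_of_poly (q b) * (N ^ b * D ^ (L - b))"
        using MD by (simp add: poly_monom mult.assoc)
      then show "poly (monom (fps_of_poly (q b)) b) M * D ^ L = (\<Sum>a\<le>L. fps_const (c (a, b)) * e (a, b))"
        by (simp add: q_def fps_of_poly_sum fps_of_poly_monom sum_distrib_right e_def mult.assoc)
    qed
    also have "\<dots> = (\<Sum>i\<in>I. fps_const (c i) * e i)"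
      unfolding I_def by (subst sum.swap) (simp add: sum.cartesian_product case_prod_unfold)
    finally show ?thesis using c(2) D(2) by simp
  qed
  ultimately show ?thesis by blast
qed

end

text \<open>In terms of \<open>y = z ^ 2 * V\<close>, the product \<open>z ^ 5 * S_pol V z w\<close>
  is a polynomial in \<open>z\<close> and \<open>y\<close> of degree 5 in \<open>y\<close> whose
  leading coefficient is a nonzero constant; so \<open>y ^ 5\<close> reduces to lower
  powers.\<close>

lemma R_fun_algebraic:
  fixes z V :: "'a::field fps"
  assumes z0: "fps_nth z 0 = 0" and t: "z * (1 - z) ^ 3 = fps_X"
    and S: "S_pol V z (fps_const c) = 0" and c: "c + c^2 + c^3 + c^4 + c^5 \<noteq> 0"
  shows "\<exists>p :: 'a fps poly. p \<noteq> 0 \<and> (\<forall>i. \<exists>q. coeff p i = fps_of_poly q) \<and> poly p (R_fun z V (fps_const c)) = 0"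
proof -
  define w where "w = fps_const c"
  define y where "y = z ^ 2 * V"
  interpret reduced_span z y 5 .
  have w: "growth w" unfolding w_def by (rule growth_const)
  note gr = w growth_intros
  define q0 where "q0 = z^6 - 2*z^7"
  define q1 where "q1 = 2*z^4 - w^2*z^3 + 3*w^2*z^4 - 3*z^5 - w*z^5 - 4*w^2*z^5 - 2*z^6 + 3*w*z^6 + 4*w^2*z^6"
  define q2 where "q2 = w^5*z - w^2*z + z^2 + 3*w^2*z^2 + w^3*z^2 + w^4*z^2 - 4*w^5*z^2 - 2*w*z^3 - 5*w^2*z^3 - 5*w^3*z^3 - 5*w^4*z^3 + 4*w^5*z^3 - 4*z^4 + 5*w*z^4 + 6*w^2*z^4 + 7*w^3*z^4 + 7*w^4*z^4 + 4*w*z^5 + 4*w^2*z^5 - 2*w^3*z^5 - 2*w^4*z^5"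
  define q3 where "q3 = w^3 + w^4 + w^5 + z - w*z - w^2*z - 5*w^3*z - 5*w^4*z - 6*w^5*z - 2*z^2 + w*z^2 + w^2*z^2 + 5*w^3*z^2 + 5*w^4*z^2 + 8*w^5*z^2 + 8*w*z^3 + 8*w^2*z^3 + 3*w^3*z^3 + 3*w^4*z^3 + w*z^4 + w^2*z^4 - w^3*z^4 - w^4*z^4"
  define q4 where "q4 = 4*w*z - w - w^2 - 2*w^3 - 2*w^4 - 2*w^5 + 4*w^2*z + 5*w^3*z + 5*w^4*z + 5*w^5*z + 2*w*z^2 + 2*w^2*z^2"
  have g: "growth q0" "growth q1" "growth q2" "growth q3" "growth q4"
    unfolding q0_def q1_def q2_def q3_def q4_def by (intro gr)+
  have "(w + w^2 + w^3 + w^4 + w^5) * y ^ 5 + (q4 * y ^ 4 + q3 * y ^ 3 + q2 * y ^ 2 + q1 * y ^ 1 + q0 * y ^ 0) = z ^ 5 * S_pol V z w"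
    unfolding y_def q0_def q1_def q2_def q3_def q4_def S_pol_def by algebra
  then have "(w + w^2 + w^3 + w^4 + w^5) * y ^ 5 = - 1 * (q4 * y ^ 4 + q3 * y ^ 3 + q2 * y ^ 2 + q1 * y ^ 1 + q0 * y ^ 0)"
    using S[folded w_def] by algebra
  moreover have "w + w^2 + w^3 + w^4 + w^5 = fps_const (c + c^2 + c^3 + c^4 + c^5)"
    by (simp add: w_def fps_const_power)
  moreover define k where "k = c + c^2 + c^3 + c^4 + c^5"
  ultimately have "fps_const k * y ^ 5 = - 1 * (q4 * y ^ 4 + q3 * y ^ 3 + q2 * y ^ 2 + q1 * y ^ 1 + q0 * y ^ 0)"
    by simp
  then have "fps_const (inverse k) * (fps_const k * y ^ 5) = fps_const (inverse k) * (- 1 * (q4 * y ^ 4 + q3 * y ^ 3 + q2 * y ^ 2 + q1 * y ^ 1 + q0 * y ^ 0))"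
    by (rule arg_cong)
  moreover have "fps_const (inverse k) * (fps_const k * y ^ 5) = y ^ 5"
    using c unfolding k_def[symmetric] by (simp flip: mult.assoc)
  ultimately have "y ^ 5 = fps_const (inverse k) * (- 1 * (q4 * y ^ 4 + q3 * y ^ 3 + q2 * y ^ 2 + q1 * y ^ 1 + q0 * y ^ 0))"
    by simp
  also have "reduced \<dots>"
    by (intro reduced_mult reduced_add reduced_power g growth_const growth_minus growth_1) simp_all
  finally have gy: "growth y" by (rule growth_y)
  define num where "num = (V*z^2 - z^2 + 3*z - 1) * V * w^2"
  define den where "den = V*z^4 - 3*V*z^3 + 3*V*z^2 + z^3 - V*z - 3*z^2 + 3*z - 1"
  have den0: "fps_nth den 0 \<noteq> 0"
    by (simp add: den_def z0 power2_eq_square power3_eq_cube power4_eq_xxxx)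
  have z: "z \<noteq> 0" using t by auto
  \<comment> \<open>The factor \<open>z ^ 4\<close> is enough to express numerator and denominator
    through \<open>y\<close> and \<open>z\<close>.\<close>
  have "growth ((y - z ^ 2 + 3 * z - 1) * y * w ^ 2 * z ^ 2)"
    by (intro gr gy)
  also have "(y - z ^ 2 + 3 * z - 1) * y * w ^ 2 * z ^ 2 = z ^ 4 * num"
    unfolding num_def y_def by algebra
  finally have N: "growth (z ^ 4 * num)" .
  have "growth (y * z ^ 6 - 3 * y * z ^ 5 + 3 * y * z ^ 4 - y * z ^ 3 + (z ^ 3 - 3 * z ^ 2 + 3 * z - 1) * z ^ 4)"
    by (intro gr gy)
  also have "y * z ^ 6 - 3 * y * z ^ 5 + 3 * y * z ^ 4 - y * z ^ 3 + (z ^ 3 - 3 * z ^ 2 + 3 * z - 1) * z ^ 4 = z ^ 4 * den"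
    unfolding den_def y_def by algebra
  finally have D: "growth (z ^ 4 * den)" .
  have T: "growth fps_X" unfolding t[symmetric] by (intro gr)
  have "den \<noteq> 0" using den0 by auto
  then have D': "z ^ 4 * den \<noteq> 0" using z by simp
  have "inverse den * den = 1" using den0 by (rule inverse_mult_eq_1)
  then have "R_fun z V w * (z ^ 4 * den) = z ^ 4 * num"
    unfolding R_fun_def num_def[symmetric] den_def[symmetric] by (simp add: mult_ac)
  from algebraic_quotient[OF _ T N D D' this] show ?thesis by (simp add: w_def)
qed

section \<open>The generating function M(1,1)\<close>

lemma wvar_facts:
  "wvar \<noteq> 0" "wvar \<noteq> 1" "wvar + wvar^2 + wvar^3 + wvar^4 + wvar^5 \<noteq> 0"
proof -
  have pow: "wvar ^ n = Fract ([:0, 1:] ^ n) 1" for n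
    by (induction n) (simp_all add: wvar_def One_fract_def)
  show "wvar \<noteq> 0" "wvar \<noteq> 1"
    by (simp_all add: wvar_def Zero_fract_def One_fract_def eq_fract one_pCons)
  have "[:0, 1:] + [:0, 1:]^2 + [:0, 1:]^3 + [:0, 1:]^4 + [:0, 1 :: rat:]^5 \<noteq> 0" (is "?p \<noteq> 0")
  proof
    assume "?p = 0"
    then have "poly ?p 1 = 0" by (metis poly_0)
    then show False by simp
  qed
  moreover have "wvar + wvar^2 + wvar^3 + wvar^4 + wvar^5 = Fract ?p 1"
    unfolding pow by (simp add: wvar_def)
  ultimately show "wvar + wvar^2 + wvar^3 + wvar^4 + wvar^5 \<noteq> 0"
    by (simp add: Zero_fract_def eq_fract)
qed

lemma infinite_fract: "infinite (UNIV :: rat poly fract set)"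
proof -
  have "inj (\<lambda>c :: rat. Fract [:c:] 1)" by (auto intro: injI simp: eq_fract)
  moreover have "infinite (UNIV :: rat set)" by (rule infinite_UNIV_char_0)
  ultimately show ?thesis by (metis finite_imageD finite_subset subset_UNIV)
qed

lemma height_weight_powi:
  assumes "(c :: 'a::field) \<noteq> 0"
  shows "height_weight (\<lambda>i. fps_const (c powi i))"
  using assms by unfold_locales (simp_all add: power_int_add)

text \<open>At x = y = 1 the coefficients are constant in the inner variable, so only k = n
  contributes to the diagonal sum. Up-steps are numbered from 1 in \<open>tilde\<close> and from 0
  in \<open>hgts\<close>.\<close>

lemma M11_eq_diag: "M11 = diag (height_weight.M_ser (\<lambda>i. fps_const (wvar powi i)) 1 1)"
proof (rule fps_ext)
  fix n
  interpret height_weight "\<lambda>i. fps_const (wvar powi i)"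
    by (rule height_weight_powi) (rule wvar_facts)
  define m where "m P Q = (\<Sum>i<size P. wvar powi (hgts Q ! i - 3 * hgts P ! i))" for P Q
  have mk: "marked 1 1 P Q = fps_const (m P Q)" for P Q
    by (rule fps_ext) (simp add: marked_def m_def fps_sum_nth)
  have "fps_nth (diag (M_ser 1 1)) n = (\<Sum>k\<le>n. if k = n then \<Sum>(P, Q)\<in>tree_intervals n. m P Q else 0)"
    unfolding diag_nth M_ser_def mk fps_nth_Abs_fps
    by (rule sum.cong) (auto simp: fps_sum_nth case_prod_unfold)
  also have "\<dots> = (\<Sum>(P, Q)\<in>tree_intervals n. m P Q)" by simp
  also have "\<dots> = (\<Sum>(P, Q)\<in>tree_intervals n. \<Sum>j = 1..n. wvar powi (tilde (word Q) j - 3 * tilde (word P) j))"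
    by (rule sum.cong) (auto simp: m_def tree_intervals_def sum.atLeast1_atMost_eq tilde_word intro!: sum.cong)
  finally show "fps_nth M11 n = fps_nth (diag (M_ser 1 1)) n"
    by (simp add: M11_def sum_intervals)
qed

theorem theorem4p2:
  fixes z V0 :: "rat poly fract fps"
  assumes z0: "fps_nth z 0 = 0"
      and zeq: "z * (1 - z) ^ 3 = fps_X"
      and V00: "fps_nth V0 0 = 0"
      and V0eq: "S_pol V0 fps_X (fps_const wvar) = 0"
  shows "(\<exists>p :: rat poly fract fps poly. p \<noteq> 0 \<and> (\<forall>i. \<exists>q. coeff p i = fps_of_poly q) \<and> poly p M11 = 0)
         \<and> M11 = R_fun z (fps_compose V0 z) (fps_const wvar)"
proof -
  have V: "fps_nth (V0 oo z) 0 = 0" using V00 z0 by simp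
  have S: "S_pol (V0 oo z) z (fps_const wvar) = 0"
    using S_pol_compose[OF z0, of V0 wvar] V0eq by simp
  have M: "M11 = R_fun z (V0 oo z) (fps_const wvar)"
    unfolding M11_eq_diag
    by (rule diag_M_ser_eq_R_fun[OF infinite_fract height_weight_powi z0 zeq V S refl]) (simp_all add: wvar_facts)
  with R_fun_algebraic[OF z0 zeq S wvar_facts(3)] show ?thesis by simp
qed

end
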